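(* The Gamified Katětov order $\leq_{\mathrm{LT}}^{\mathsf o}$ is a preorder on upper sets over $\omega$. Moreover, for all upper sets $\mathcal U,\mathcal V\subseteq\mathcal P(\omega)$: (i) $\mathcal U\leq_{\mathrm{LT}}^{\mathsf o}\mathcal V$ if and only if there exists a $\mathcal V$-fence $\delta$ such that $\mathcal U\leq_{\mathrm K}\mathcal V^{\otimes[\delta]}$. In particular, $\mathcal U\equiv_{\mathrm{LT}}^{\mathsf o}\mathcal U\otimes\mathcal U$, and $\leq_{\mathrm{LT}}^{\mathsf o}$ is strictly coarser than both the Rudin–Keisler order and the Katětov order on upper sets. (ii) $\mathcal U\leq_{\mathrm{LT}}^{\mathsf o}\mathcal V$ if and only if Player II has a winning strategy in the finite-query Katětov game $\mathfrak G(\mathcal U,\mathcal V)$. (iii) $\mathcal U$ is computable Gamified Katětov reducible to $\mathcal V$ (that is, Player II has a winning strategy in $\mathfrak G(\mathcal U,\mathcal V)$ in which the strategy of Player II$_0$ is computable) if and only if $\mathcal U\leq_{\mathrm{LT}}\mathcal V$.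
   Context: **Upper sets.** An upper set is a nonempty family $\mathcal U\subseteq\mathcal P(\omega)$, closed upwards under $\subseteq$, with $\emptyset\notin\mathcal U$. **Rudin–Keisler and Katětov.** $\mathcal U\leq_{\mathrm{RK}}\mathcal V$ iff there is $h\colon\omega\to\omega$ with $A\in\mathcal U\iff h^{-1}[A]\in\mathcal V$ for all $A\subseteq\omega$. $\mathcal U\leq_{\mathrm K}\mathcal V$ iff there is $h\colon\omega\to\omega$ with $A\in\mathcal U\Rightarrow h^{-1}[A]\in\mathcal V$ for all $A\subseteq\omega$. "$\leq_{\mathrm{LT}}^{\mathsf o}$ is strictly coarser than $\leq$" means that $\mathcal U\leq\mathcal V$ implies $\mathcal U\leq_{\mathrm{LT}}^{\mathsf o}\mathcal V$, but not conversely. **Fubini product.** For $A\subseteq\omega^2$ put $A_{(m)}=\{l:(m,l)\in A\}$; $A\in\mathcal U\otimes\mathcal V\iff\{m: A_{(m)}\in\mathcal V\}\in\mathcal U$. It is regarded as an upper set on $\omega$ via a fixed computable bijection $\langle-,-\rangle\colon\omega^2\to\omega$. **Strings and trees.** $\omega^{<\omega}$ is the set of finite strings, $\preceq$ the prefix relation, $\sigma^\frown n$ the extension of $\sigma$ by $n$, $p\upharpoonright n$ the prefix of length $n$. An antichain is a set of pairwise $\preceq$-incomparable strings. A tree is a subset $T\subseteq\omega^{<\omega}$ containing the empty string and closed under prefixes; $[T]$ is its set of infinite paths. $T$ is $\mathcal V$-branching if $\{n:\sigma^\frown n\in T\}\in\mathcal V$ for every $\sigma\in T$ (including the root). **Partial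 continuous functions.** A partial continuous function $\Phi\colon\subseteq\omega^\omega\to\omega$ is one determined by a partial function $\varphi\colon\subseteq\omega^{<\omega}\to\omega$ that is coherent ($\sigma\preceq\tau$ both in $\mathrm{dom}(\varphi)$ implies $\varphi(\sigma)=\varphi(\tau)$) via: $\Phi(p)$ is defined with value $c$ iff $\varphi(p\upharpoonright n)=c$ for some $n$. **Gamified Katětov order.** $\mathcal U\leq_{\mathrm{LT}}^{\mathsf o}\mathcal V$ iff there is a partial continuous $\Phi\colon\subseteq\omega^\omega\to\omega$ such that for every $A\in\mathcal U$ there is a $\mathcal V$-branching tree $T$ with $[T]\subseteq\mathrm{dom}(\Phi)$ and $\Phi(p)\in A$ for all $p\in[T]$. $\equiv_{\mathrm{LT}}^{\mathsf o}$ means $\leq_{\mathrm{LT}}^{\mathsf o}$ in both directions. **$\delta$-Fubini powers.** Let $\delta\subseteq\omega^{<\omega}$ be an antichain. A (nonempty) tree $T$ is $\mathcal V$-branching up to $\delta$ if every $x\in[T]$ has some prefix $x\upharpoonright n\in\delta$, and for every $\sigma\in T$ either $\sigma\in\delta$ or $\{n:\sigma^\frown n\in T\}\in\mathcal V$. A $\mathcal V$-fence is an antichain $\delta$ for which some tree is $\mathcal V$-branching up to $\delta$. Fix a computable bijection $\lceil-\rceil\colon\omega^{<\omega}\to\omega$. For a $\mathcal V$-fence $\delta$, $\mathcal V^{\otimes[\delta]}$ is the upward closure in $\mathcal P(\omega)$ of $\{\lceil T\cap\delta\rceil : T\text{ is }\mathcal V\text{-branching up to }\delta\}$, where $\lceil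 S\rceil=\{\lceil\sigma\rceil:\sigma\in S\}$. **Finite-query Katětov game $\mathfrak G(\mathcal U,\mathcal V)$.** Player I plays against the team II $=$ II$_0+$II$_1$. Player I first chooses $A\in\mathcal U$. At round $n=0,1,2,\dots$, II$_0$ either makes a query (move $0$) or terminates the game with an output $y\in\omega$ (move $\langle1,y\rangle$); at round $0$ it must query. If a query is made, II$_1$ chooses $B_n\in\mathcal V$ and Player I replies with $x_{n+1}\in B_n$, beginning round $n+1$. II$_0$ sees only $x_1,\dots,x_n$; its strategy is a partial function $\psi\colon\subseteq\omega^{<\omega}\to\omega$, with value $0$ at the empty string. II$_1$ sees $A,x_1,\dots,x_n$; its strategy is an arbitrary partial function $\eta\colon\subseteq\mathcal P(\omega)\times\omega^{<\omega}\to\mathcal P(\omega)$. Strategies are fixed in advance, independently of $A$. Player II's strategy is winning if every play following it terminates legally (after finitely many rounds) with $y\in A$, or Player I violates the rules first. It is computable for II$_0$ if $\psi$ is partial computable. **Lawvere–Tierney order.** Let $\varphi_e$ be the $e$-th partial computable function and for $p,q\subseteq\omega$ put $p\to q=\{e:\forall a\in p,\ \varphi_e(a)\text{ is defined and in }q\}$. For functions $j,k\colon\mathcal P(\omega)\to\mathcal P(\omega)$ a universally quantified realisability statement is valid if a single $e\in\omega$ realises it for all arguments. An LT topology (in the Effective Topos) is $j\colon\mathcal P(\omega)\to\mathcal P(\omega)$ such that the following are valid: $(p\to q)\to(j(p)\to j(q))$; $p\to j(p)$; $j(j(p))\leftrightarrow j(p)$. Write $j\leq_{\mathrm{LT}}k$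 iff $\forall p.\ j(p)\to k(p)$ is valid. For $\mathcal A\subseteq\mathcal P(\omega)$, the basic topology $j_{\mathcal A}$ is the ($\leq_{\mathrm{LT}}$-equivalence class of the) $\leq_{\mathrm{LT}}$-least LT topology $j$ such that $\forall p.\ G_{\mathcal A}(p)\to j(p)$ is valid, where $G_{\mathcal A}(p)=\bigcup_{A\in\mathcal A}(A\to p)$. For upper sets, $\mathcal U\leq_{\mathrm{LT}}\mathcal V$ means $j_{\mathcal U}\leq_{\mathrm{LT}}j_{\mathcal V}$. *)

theory Defs
  imports "HOL-Library.Nat_Bijection" "HOL-Library.Sublist"
begin

text \<open>
  Throughout, \<^const>\<open>prod_encode\<close> and \<^const>\<open>list_encode\<close> serve as the fixed computable bijections
  \<open>\<omega>\<^sup>2 \<rightarrow> \<omega>\<close> and \<open>\<omega>\<^sup><\<^sup>\<omega> \<rightarrow> \<omega>\<close>.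
\<close>

definition upper_set :: "nat set set \<Rightarrow> bool" where
  "upper_set \<U> \<longleftrightarrow> \<U> \<noteq> {} \<and> {} \<notin> \<U> \<and> (\<forall>A B. A \<in> \<U> \<longrightarrow> A \<subseteq> B \<longrightarrow> B \<in> \<U>)"

definition rudin_keisler_le :: "nat set set \<Rightarrow> nat set set \<Rightarrow> bool" (infix "\<le>\<^sub>R\<^sub>K" 50) where
  "\<U> \<le>\<^sub>R\<^sub>K \<V> \<longleftrightarrow> (\<exists>h :: nat \<Rightarrow> nat. \<forall>A. A \<in> \<U> \<longleftrightarrow> h -` A \<in> \<V>)"

definition katetov_le :: "nat set set \<Rightarrow> nat set set \<Rightarrow> bool" (infix "\<le>\<^sub>K" 50) where
  "\<U> \<le>\<^sub>K \<V> \<longleftrightarrow> (\<exists>h :: nat \<Rightarrow> nat. \<forall>A. A \<in> \<U> \<longrightarrow> h -` A \<in> \<V>)"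

definition fubini_product_pairs :: "nat set set \<Rightarrow> nat set set \<Rightarrow> (nat \<times> nat) set set" where
  "fubini_product_pairs \<U> \<V> = {A. {m. {l. (m, l) \<in> A} \<in> \<V>} \<in> \<U>}"

definition fubini_product :: "nat set set \<Rightarrow> nat set set \<Rightarrow> nat set set" (infixr "\<otimes>" 70) where
  "\<U> \<otimes> \<V> = (\<lambda>A. prod_encode ` A) ` fubini_product_pairs \<U> \<V>"

definition strictly_coarser ::
    "(nat set set \<Rightarrow> nat set set \<Rightarrow> bool) \<Rightarrow> (nat set set \<Rightarrow> nat set set \<Rightarrow> bool) \<Rightarrow> bool" where
  "strictly_coarser R S \<longleftrightarrow>
     (\<forall>\<U> \<V>. upper_set \<U> \<longrightarrow> upper_set \<V> \<longrightarrow> S \<U> \<V> \<longrightarrow> R \<U> \<V>) \<and>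
     (\<exists>\<U> \<V>. upper_set \<U> \<and> upper_set \<V> \<and> R \<U> \<V> \<and> \<not> S \<U> \<V>)"

abbreviation restr :: "(nat \<Rightarrow> nat) \<Rightarrow> nat \<Rightarrow> nat list" (infixl "\<restriction>" 80) where
  "p \<restriction> n \<equiv> map p [0..<n]"

definition tree :: "nat list set \<Rightarrow> bool" where
  "tree T \<longleftrightarrow> [] \<in> T \<and> (\<forall>\<sigma> \<tau>. \<tau> \<in> T \<longrightarrow> prefix \<sigma> \<tau> \<longrightarrow> \<sigma> \<in> T)"

definition paths :: "nat list set \<Rightarrow> (nat \<Rightarrow> nat) set" where
  "paths T = {p. \<forall>n. p \<restriction> n \<in> T}"

definition branching :: "nat set set \<Rightarrow> nat list set \<Rightarrow> bool" where
  "branching \<V> T \<longleftrightarrow> (\<forall>\<sigma>\<in>T. {n. \<sigma> @ [n] \<in> T} \<in> \<V>)"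

definition coherent :: "(nat list \<rightharpoonup> nat) \<Rightarrow> bool" where
  "coherent \<phi> \<longleftrightarrow> (\<forall>\<sigma>\<in>dom \<phi>. \<forall>\<tau>\<in>dom \<phi>. prefix \<sigma> \<tau> \<longrightarrow> \<phi> \<sigma> = \<phi> \<tau>)"

definition partial_continuous :: "((nat \<Rightarrow> nat) \<rightharpoonup> nat) \<Rightarrow> bool" where
  "partial_continuous \<Phi> \<longleftrightarrow>
     (\<exists>\<phi>. coherent \<phi> \<and> (\<forall>p c. \<Phi> p = Some c \<longleftrightarrow> (\<exists>n. \<phi> (p \<restriction> n) = Some c)))"

definition gamified_katetov_le :: "nat set set \<Rightarrow> nat set set \<Rightarrow> bool" (infix "\<le>\<^sub>L\<^sub>T\<^sup>o" 50) where
  "\<U> \<le>\<^sub>L\<^sub>T\<^sup>o \<V> \<longleftrightarrow>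
     (\<exists>\<Phi>. partial_continuous \<Phi> \<and>
        (\<forall>A\<in>\<U>. \<exists>T. tree T \<and> branching \<V> T \<and>
           paths T \<subseteq> dom \<Phi> \<and> (\<forall>p\<in>paths T. the (\<Phi> p) \<in> A)))"

definition gamified_katetov_equiv :: "nat set set \<Rightarrow> nat set set \<Rightarrow> bool" (infix "\<equiv>\<^sub>L\<^sub>T\<^sup>o" 50) where
  "\<U> \<equiv>\<^sub>L\<^sub>T\<^sup>o \<V> \<longleftrightarrow> \<U> \<le>\<^sub>L\<^sub>T\<^sup>o \<V> \<and> \<V> \<le>\<^sub>L\<^sub>T\<^sup>o \<U>"

definition antichain :: "nat list set \<Rightarrow> bool" where
  "antichain \<delta> \<longleftrightarrow> pairwise parallel \<delta>"

text \<open>\<open>T\<close> may continue beyond \<open>\<delta>\<close>; only \<open>T \<inter> \<delta>\<close> matters below.\<close>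

definition branching_up_to :: "nat set set \<Rightarrow> nat list set \<Rightarrow> nat list set \<Rightarrow> bool" where
  "branching_up_to \<V> \<delta> T \<longleftrightarrow> tree T \<and>
     (\<forall>x\<in>paths T. \<exists>n. x \<restriction> n \<in> \<delta>) \<and>
     (\<forall>\<sigma>\<in>T. \<sigma> \<in> \<delta> \<or> {n. \<sigma> @ [n] \<in> T} \<in> \<V>)"

definition fence :: "nat set set \<Rightarrow> nat list set \<Rightarrow> bool" where
  "fence \<V> \<delta> \<longleftrightarrow> antichain \<delta> \<and> (\<exists>T. branching_up_to \<V> \<delta> T)"

definition fubini_power :: "nat set set \<Rightarrow> nat list set \<Rightarrow> nat set set" where
  "fubini_power \<V> \<delta> = {A. \<exists>T. branching_up_to \<V> \<delta> T \<and> list_encode ` (T \<inter> \<delta>) \<subseteq> A}"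

text \<open>
  The partial recursive functions of one argument, presented with the pairing function
  \<^const>\<open>prod_encode\<close> in place of argument tuples: \<open>Prec f g\<close> maps \<open>\<langle>a, 0\<rangle>\<close> to \<open>f a\<close> and
  \<open>\<langle>a, k + 1\<rangle>\<close> to \<open>g \<langle>a, \<langle>k, r\<rangle>\<rangle>\<close> for \<open>r\<close> the value at \<open>\<langle>a, k\<rangle>\<close>, and \<open>Mu f\<close> is unbounded
  search for the least \<open>k\<close> with \<open>f \<langle>a, k\<rangle> = 0\<close>, all earlier values having to be defined.
\<close>

datatype code =
    Zero | Succ | Proj1 | Proj2
  | Tuple code code | Comp code code | Prec code code | Mu code

primrec eval_code :: "code \<Rightarrow> nat \<rightharpoonup> nat" where
  "eval_code Zero a = Some 0"
| "eval_code Succ a = Some (Suc a)"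
| "eval_code Proj1 a = Some (fst (prod_decode a))"
| "eval_code Proj2 a = Some (snd (prod_decode a))"
| "eval_code (Tuple f g) a =
     Option.bind (eval_code f a) (\<lambda>x.
     Option.bind (eval_code g a) (\<lambda>y. Some (prod_encode (x, y))))"
| "eval_code (Comp f g) a = Option.bind (eval_code g a) (eval_code f)"
| "eval_code (Prec f g) a =
     rec_nat (eval_code f (fst (prod_decode a)))
       (\<lambda>k v. Option.bind v (\<lambda>r.
          eval_code g (prod_encode (fst (prod_decode a), prod_encode (k, r)))))
       (snd (prod_decode a))"
| "eval_code (Mu f) a =
     (if \<exists>k. eval_code f (prod_encode (a, k)) = Some 0 \<and>
             (\<forall>i<k. eval_code f (prod_encode (a, i)) \<noteq> None)
      then Some (LEAST k. eval_code f (prod_encode (a, k)) = Some 0)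
      else None)"

primrec encode_code :: "code \<Rightarrow> nat" where
  "encode_code Zero = 0"
| "encode_code Succ = 1"
| "encode_code Proj1 = 2"
| "encode_code Proj2 = 3"
| "encode_code (Tuple f g) = 4 * prod_encode (encode_code f, encode_code g) + 4"
| "encode_code (Comp f g) = 4 * prod_encode (encode_code f, encode_code g) + 5"
| "encode_code (Prec f g) = 4 * prod_encode (encode_code f, encode_code g) + 6"
| "encode_code (Mu f) = 4 * encode_code f + 7"

lemma inj_encode_code: "inj encode_code"
proof (rule injI)
  fix c d :: code
  have mod_neq: "4 * x + i \<noteq> 4 * y + j" if "i mod 4 \<noteq> j mod 4" for x y i j :: nat
    using that by (metis mod_mult_self4)
  show "encode_code c = encode_code d \<Longrightarrow> c = d"
  proof (induction c arbitrary: d)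
    case (Tuple f g) then show ?case by (cases d) (auto simp: mod_neq)
  next
    case (Comp f g) then show ?case by (cases d) (auto simp: mod_neq)
  next
    case (Prec f g) then show ?case by (cases d) (auto simp: mod_neq)
  next
    case (Mu f) then show ?case by (cases d) (auto simp: mod_neq)
  qed (case_tac d; simp)+
qed

lemma surj_encode_code: "surj encode_code"
proof -
  have "\<exists>c. encode_code c = e" for e
  proof (induction e rule: less_induct)
    case (less e)
    show ?case
    proof (cases "e < 4")
      case True
      then consider "e = 0" | "e = 1" | "e = 2" | "e = 3" by linarith
      then show ?thesis by (metis encode_code.simps(1-4))
    next
      case False
      define k where "k = (e - 4) div 4"
      have e: "e = 4 * k + 4 + (e - 4) mod 4" and "k < e"
        using False unfolding k_def by presburger+
      obtain a b where ab: "k = prod_encode (a, b)"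
        by (metis prod_decode_inverse surj_pair)
      have "a < e" "b < e"
        using \<open>k < e\<close> ab le_prod_encode_1[of a b] le_prod_encode_2[of b a] by linarith+
      with \<open>k < e\<close> obtain f g h where
        "encode_code f = a" "encode_code g = b" "encode_code h = k"
        using less by metis
      moreover consider "e = 4 * k + 4" | "e = 4 * k + 5" | "e = 4 * k + 6" | "e = 4 * k + 7"
        using e by linarith
      ultimately show ?thesis
        using ab by (metis encode_code.simps(5-8))
    qed
  qed
  then show ?thesis by (metis surjI surj_def)
qed

lemma bij_encode_code: "bij encode_code"
  by (rule bijI[OF inj_encode_code surj_encode_code])

definition phi :: "nat \<Rightarrow> nat \<rightharpoonup> nat" where
  "phi e = eval_code (inv encode_code e)"

definition partial_computable_on_strings :: "(nat list \<rightharpoonup> nat) \<Rightarrow> bool" where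
  "partial_computable_on_strings \<psi> \<longleftrightarrow> (\<exists>e. \<forall>\<sigma>. \<psi> \<sigma> = phi e (list_encode \<sigma>))"

text \<open>
  The positions \<open>[x\<^sub>1, \<dots>, x\<^sub>n]\<close> that Player I can reach by legal replies
  after opening with \<open>A\<close>, when Player II follows \<open>(\<psi>, \<eta>)\<close>.
\<close>

inductive position ::
    "(nat list \<rightharpoonup> nat) \<Rightarrow> (nat set \<times> nat list \<rightharpoonup> nat set) \<Rightarrow> nat set \<Rightarrow> nat list \<Rightarrow> bool"
  for \<psi> \<eta> A where
  start: "position \<psi> \<eta> A []"
| reply: "position \<psi> \<eta> A \<sigma> \<Longrightarrow> \<psi> \<sigma> = Some 0 \<Longrightarrow> \<eta> (A, \<sigma>) = Some B \<Longrightarrow> x \<in> B \<Longrightarrow>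
          position \<psi> \<eta> A (\<sigma> @ [x])"

text \<open>
  Along every play in which Player I obeys the rules, each move of Player II is legal,
  the play is finite, and the output lies in \<open>A\<close>. A query is coded by \<open>0\<close> and the output
  \<open>y\<close> by \<open>\<langle>1, y\<rangle>\<close>, which is never \<open>0\<close>.
\<close>

definition winning_strategy ::
    "nat set set \<Rightarrow> nat set set \<Rightarrow>
     (nat list \<rightharpoonup> nat) \<Rightarrow> (nat set \<times> nat list \<rightharpoonup> nat set) \<Rightarrow> bool" where
  "winning_strategy \<U> \<V> \<psi> \<eta> \<longleftrightarrow> \<psi> [] = Some 0 \<and>
     (\<forall>A\<in>\<U>.
        (\<forall>\<sigma>. position \<psi> \<eta> A \<sigma> \<longrightarrow>
           (\<psi> \<sigma> = Some 0 \<and> (\<exists>B\<in>\<V>. \<eta> (A, \<sigma>) = Some B)) \<or>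
           (\<exists>y\<in>A. \<psi> \<sigma> = Some (prod_encode (1, y)))) \<and>
        \<not> (\<exists>x. \<forall>n. position \<psi> \<eta> A (x \<restriction> n)))"

definition player_II_wins :: "nat set set \<Rightarrow> nat set set \<Rightarrow> bool" where
  "player_II_wins \<U> \<V> \<longleftrightarrow> (\<exists>\<psi> \<eta>. winning_strategy \<U> \<V> \<psi> \<eta>)"

definition computably_gamified_katetov_le :: "nat set set \<Rightarrow> nat set set \<Rightarrow> bool" where
  "computably_gamified_katetov_le \<U> \<V> \<longleftrightarrow>
     (\<exists>\<psi> \<eta>. partial_computable_on_strings \<psi> \<and> winning_strategy \<U> \<V> \<psi> \<eta>)"

definition rimp :: "nat set \<Rightarrow> nat set \<Rightarrow> nat set" (infixr "\<rightarrow>\<^sub>r" 55) where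
  "p \<rightarrow>\<^sub>r q = {e. \<forall>a\<in>p. \<exists>b\<in>q. phi e a = Some b}"

text \<open>A biconditional is the conjunction of its two directions, realised by pairs.\<close>

definition riff :: "nat set \<Rightarrow> nat set \<Rightarrow> nat set" (infix "\<leftrightarrow>\<^sub>r" 54) where
  "p \<leftrightarrow>\<^sub>r q = {prod_encode (d, e) | d e. d \<in> p \<rightarrow>\<^sub>r q \<and> e \<in> q \<rightarrow>\<^sub>r p}"

definition valid :: "('a \<Rightarrow> nat set) \<Rightarrow> bool" where
  "valid F \<longleftrightarrow> (\<exists>e. \<forall>x. e \<in> F x)"

definition LT_topology :: "(nat set \<Rightarrow> nat set) \<Rightarrow> bool" where
  "LT_topology j \<longleftrightarrow>
     valid (\<lambda>(p, q). (p \<rightarrow>\<^sub>r q) \<rightarrow>\<^sub>r (j p \<rightarrow>\<^sub>r j q)) \<and>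
     valid (\<lambda>p. p \<rightarrow>\<^sub>r j p) \<and>
     valid (\<lambda>p. j (j p) \<leftrightarrow>\<^sub>r j p)"

definition topology_le :: "(nat set \<Rightarrow> nat set) \<Rightarrow> (nat set \<Rightarrow> nat set) \<Rightarrow> bool" where
  "topology_le j k \<longleftrightarrow> valid (\<lambda>p. j p \<rightarrow>\<^sub>r k p)"

definition G_op :: "nat set set \<Rightarrow> nat set \<Rightarrow> nat set" where
  "G_op \<A> p = (\<Union>A\<in>\<A>. A \<rightarrow>\<^sub>r p)"

text \<open>
  \<open>j\<^sub>\<A>\<close> is determined only up to \<^const>\<open>topology_le\<close>-equivalence, so it is represented by the
  set of all \<^const>\<open>topology_le\<close>-least topologies above \<^term>\<open>G_op \<A>\<close>. Any two of them are
  equivalent, hence the choice of representatives in \<open>LT_le\<close> is immaterial.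
\<close>

definition basic_topology :: "nat set set \<Rightarrow> (nat set \<Rightarrow> nat set) set" where
  "basic_topology \<A> =
     {j. LT_topology j \<and> valid (\<lambda>p. G_op \<A> p \<rightarrow>\<^sub>r j p) \<and>
         (\<forall>k. LT_topology k \<longrightarrow> valid (\<lambda>p. G_op \<A> p \<rightarrow>\<^sub>r k p) \<longrightarrow> topology_le j k)}"

definition LT_le :: "nat set set \<Rightarrow> nat set set \<Rightarrow> bool" (infix "\<le>\<^sub>L\<^sub>T" 50) where
  "\<U> \<le>\<^sub>L\<^sub>T \<V> \<longleftrightarrow> (\<exists>j\<in>basic_topology \<U>. \<exists>k\<in>basic_topology \<V>. topology_le j k)"

end

theory Submission
  imports Defs
begin

text \<open>
  All the notions compared here describe one situation: team II asks finitely many questions, each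
  answered from a set in \<open>\<V>\<close>, and then names an element of \<open>A\<close>. Which sets are offered
  may depend on \<open>A\<close>, but the rule that reads the answers and produces the output may not.
  The inductive predicate \<open>forces\<close> expresses that II can make the play reach a good output, and
  every clause of the theorem is translated into it.

  A bar induction, \<open>forces_iff_barred_tree\<close>, turns \<open>forces\<close> into the existence of a tree
  that branches by sets in \<open>\<V>\<close> until it is stopped by a bar. Consequently
  \<open>\<U> \<le>\<^sub>L\<^sub>T\<^sup>o \<V>\<close> holds iff one arbitrary partial labelling \<open>\<phi>\<close> of finite strings forces an
  output in \<open>A\<close> for every \<open>A \<in> \<U>\<close>, where the output of a play is the first label it meets
  (\<open>gamified_iff_wins\<close>). The fence in (i) is the set of first labelled strings, and the
  function \<open>h\<close> is the labelling itself; the game in (ii) is the same condition with \<open>\<psi>\<close> in the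
  place of \<open>\<phi>\<close> (\<open>winning_strategy_iff_forces\<close>). Transitivity holds because each query of the
  first reduction can be answered by running the second one (\<open>gamified_trans\<close>).
  Strictness already shows up for the upper set of all \<open>A\<close> that meet \<open>{0, 1}\<close>: there a query
  transmits one bit, so two queries separate four outcomes, but a Katetov reduction has only one.

  For (iii), the set \<open>dialogues \<V> p\<close> is defined as the least \<open>X\<close> that contains \<open>\<langle>0, a\<rangle>\<close> for
  \<open>a \<in> p\<close> and \<open>\<langle>1, e\<rangle>\<close> whenever \<open>e\<close> maps some set in \<open>\<V>\<close> into \<open>X\<close>. Its elements are programs
  for the game with target \<open>p\<close>: stop with output \<open>a\<close>, or query and continue as \<open>e\<close> says. Being
  a least fixed point it is initial, uniformly in all data (\<open>dialogues_initial\<close>), and this makes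
  \<open>dialogues \<V>\<close> a basic topology of \<open>\<V>\<close>. Hence \<open>\<U> \<le>\<^sub>L\<^sub>T \<V>\<close> holds iff a single number lies in
  \<open>dialogues \<V> A\<close> for all \<open>A \<in> \<U>\<close> (\<open>LT_le_iff_common_element\<close>). Such a number is the same thing as
  a computable strategy: interpreting it along the answers received gives \<open>\<psi>\<close>, and conversely
  \<open>\<psi>\<close> unfolds into a dialogue program by self-reference. Both
  passages use the recursion theorem \<open>recursive_program\<close>, which rests on a universal
  function for the given programming language; the latter is obtained from a stack machine.
\<close>

section \<open>Forcing and barred trees\<close>

text \<open>
  \<open>P\<close> marks the good final positions and \<open>Q\<close> the positions at which a query may be made. Keeping
  \<open>Q\<close> as a parameter lets one predicate serve both labelled trees, where a play must stop at its first
  label, and strategies, where a query has to be announced.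
\<close>
inductive forces ::
    "nat set set \<Rightarrow> (nat list \<Rightarrow> bool) \<Rightarrow> (nat list \<Rightarrow> bool) \<Rightarrow> nat list \<Rightarrow> bool"
  for \<V> Q P where
  now: "P \<sigma> \<Longrightarrow> forces \<V> Q P \<sigma>"
| ask: "Q \<sigma> \<Longrightarrow> B \<in> \<V> \<Longrightarrow> (\<And>x. x \<in> B \<Longrightarrow> forces \<V> Q P (\<sigma> @ [x])) \<Longrightarrow> forces \<V> Q P \<sigma>"

lemma forces_mono:
  assumes "forces \<V> Q P \<sigma>" "\<And>\<tau>. Q \<tau> \<Longrightarrow> Q' \<tau>" "\<And>\<tau>. P \<tau> \<Longrightarrow> P' \<tau>"
  shows "forces \<V> Q' P' \<sigma>"
  using assms(1) by induction (auto intro: forces.intros assms(2,3))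

definition barred_tree ::
    "nat set set \<Rightarrow> (nat list \<Rightarrow> bool) \<Rightarrow> (nat list \<Rightarrow> bool) \<Rightarrow> nat list set \<Rightarrow> bool" where
  "barred_tree \<V> Q P S \<longleftrightarrow> tree S \<and> (\<forall>p\<in>paths S. \<exists>n. P (p \<restriction> n)) \<and>
     (\<forall>\<sigma>\<in>S. P \<sigma> \<or> Q \<sigma> \<and> {x. \<sigma> @ [x] \<in> S} \<in> \<V>)"

lemma restr_Suc: "p \<restriction> Suc n = p \<restriction> n @ [p n]"
  by simp

lemma restr_Suc_shift: "p \<restriction> Suc n = p 0 # (\<lambda>i. p (Suc i)) \<restriction> n"
  by (simp add: upt_conv_Cons map_Suc_upt[symmetric] comp_def del: upt_Suc)

lemma prefix_restr:
  assumes "prefix \<sigma> (p \<restriction> n)"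
  shows "\<sigma> = p \<restriction> length \<sigma> \<and> length \<sigma> \<le> n"
proof -
  have le: "length \<sigma> \<le> n" using prefix_length_le[OF assms] by simp
  have "\<sigma> = take (length \<sigma>) (p \<restriction> n)" using assms by (auto simp: prefix_def)
  also have "\<dots> = p \<restriction> length \<sigma>" using le by (simp add: take_map take_upt)
  finally show ?thesis using le by blast
qed

lemma restr_prefix: "m \<le> n \<Longrightarrow> prefix (p \<restriction> m) (p \<restriction> n)"
  by (metis le_add_diff_inverse map_append prefixI upt_add_eq_append zero_le)

lemma strict_prefixes_restr:
  "(\<forall>\<tau>. strict_prefix \<tau> (p \<restriction> n) \<longrightarrow> P \<tau>) \<longleftrightarrow> (\<forall>m<n. P (p \<restriction> m))"
proof (intro iffI allI impI)
  fix m assume *: "\<forall>\<tau>. strict_prefix \<tau> (p \<restriction> n) \<longrightarrow> P \<tau>" and "m < n"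
  have "length (p \<restriction> m) \<noteq> length (p \<restriction> n)" using \<open>m < n\<close> by simp
  then have "p \<restriction> m \<noteq> p \<restriction> n" by metis
  then have "strict_prefix (p \<restriction> m) (p \<restriction> n)"
    using restr_prefix[of m n p] \<open>m < n\<close> by (simp only: strict_prefix_def less_imp_le simp_thms)
  with * show "P (p \<restriction> m)" by blast
next
  fix \<tau> assume *: "\<forall>m<n. P (p \<restriction> m)" and \<tau>: "strict_prefix \<tau> (p \<restriction> n)"
  then have "\<tau> = p \<restriction> length \<tau>" using prefix_restr by (auto simp: strict_prefix_def)
  moreover have "length \<tau> < n" using prefix_length_less[OF \<tau>] by simp
  ultimately show "P \<tau>" using * by metis
qed

text \<open>
  Dependent choice for strings: an invariant that can always be kept by some one-step extension
  holds along a whole infinite sequence.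
\<close>
lemma path_through:
  assumes "I \<sigma>" and "\<And>\<tau>. I \<tau> \<Longrightarrow> \<exists>x. I (\<tau> @ [x])"
  obtains p where "p \<restriction> length \<sigma> = \<sigma>" "\<And>n. length \<sigma> \<le> n \<Longrightarrow> I (p \<restriction> n)"
proof -
  define next_value where "next_value \<tau> = (SOME x. I (\<tau> @ [x]))" for \<tau>
  define s where "s = rec_nat \<sigma> (\<lambda>_ \<tau>. \<tau> @ [next_value \<tau>])"
  have s: "s 0 = \<sigma>" "s (Suc n) = s n @ [next_value (s n)]" for n
    by (simp_all add: s_def)
  have I: "I (s n)" for n
  proof (induction n)
    case 0 then show ?case by (simp add: s assms(1))
  next
    case (Suc n)
    show ?case unfolding s next_value_def by (rule someI_ex) (rule assms(2)[OF Suc])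
  qed
  have len: "length (s n) = length \<sigma> + n" for n by (induction n) (simp_all add: s)
  define p where "p i = s (Suc i) ! i" for i
  have stable: "s (m + k) ! i = s m ! i" if "i < length (s m)" for m k i
    using that by (induction k) (auto simp: s nth_append len)
  have eq: "s n = p \<restriction> (length \<sigma> + n)" for n
  proof (rule nth_equalityI)
    show "length (s n) = length (p \<restriction> (length \<sigma> + n))" by (simp add: len)
    fix i assume "i < length (s n)"
    then have i: "i < length \<sigma> + n" by (simp add: len)
    have "s n ! i = p i"
    proof (cases "n \<le> Suc i")
      case True
      then show ?thesis using stable[of i n "Suc i - n"] i by (simp add: p_def len)
    next
      case False
      then show ?thesis using stable[of i "Suc i" "n - Suc i"] by (simp add: p_def len)
    qed
    then show "s n ! i = (p \<restriction> (length \<sigma> + n)) ! i" using i by simp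
  qed
  show ?thesis
  proof (rule that)
    show "p \<restriction> length \<sigma> = \<sigma>" using eq[of 0] by (simp add: s)
    show "I (p \<restriction> n)" if "length \<sigma> \<le> n" for n
      using I[of "n - length \<sigma>"] that by (simp add: eq)
  qed
qed

text \<open>
  From left to right, the tree is grafted together along the inductive derivation. Taking the
  tree of all forced positions would not do: in it each step could return to a position that is
  harder to finish, so it may have infinite paths that never reach \<open>P\<close>. From right to left,
  the argument is bar induction: if the root were not forced, every unforced node would have an
  unforced child, and these children would form a path avoiding \<open>P\<close>.
\<close>
theorem forces_iff_barred_tree:
  "forces \<V> Q P [] \<longleftrightarrow> (\<exists>S. barred_tree \<V> Q P S)"
proof
  assume "\<exists>S. barred_tree \<V> Q P S"
  then obtain S where S: "barred_tree \<V> Q P S" ..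
  show "forces \<V> Q P []"
  proof (rule ccontr)
    assume contra: "\<not> forces \<V> Q P []"
    let ?I = "\<lambda>\<sigma>. \<sigma> \<in> S \<and> \<not> forces \<V> Q P \<sigma>"
    have "\<exists>x. ?I (\<sigma> @ [x])" if \<sigma>: "?I \<sigma>" for \<sigma>
    proof (rule ccontr)
      assume "\<nexists>x. ?I (\<sigma> @ [x])"
      moreover from S \<sigma> have "Q \<sigma>" "{x. \<sigma> @ [x] \<in> S} \<in> \<V>"
        unfolding barred_tree_def by (blast intro: forces.now)+
      ultimately have "forces \<V> Q P \<sigma>" by (intro forces.ask[of Q \<sigma> "{x. \<sigma> @ [x] \<in> S}"]) auto
      with \<sigma> show False by blast
    qed
    moreover have "?I []" using S contra by (simp add: barred_tree_def tree_def)
    ultimately obtain p where p: "\<And>n. ?I (p \<restriction> n)"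
      using path_through[of ?I "[]"] by (metis list.size(3) zero_le)
    then have "p \<in> paths S" by (simp add: paths_def)
    with S obtain n where "P (p \<restriction> n)" unfolding barred_tree_def by blast
    with p show False by (blast intro: forces.now)
  qed
next
  have "\<exists>S. barred_tree \<V> (\<lambda>\<tau>. Q (\<sigma> @ \<tau>)) (\<lambda>\<tau>. P (\<sigma> @ \<tau>)) S" if "forces \<V> Q P \<sigma>" for \<sigma>
    using that
  proof induction
    case (now \<sigma>)
    have "barred_tree \<V> (\<lambda>\<tau>. Q (\<sigma> @ \<tau>)) (\<lambda>\<tau>. P (\<sigma> @ \<tau>)) {[]}"
      using now by (auto simp: barred_tree_def tree_def intro: exI[of _ 0])
    then show ?case by blast
  next
    case (ask \<sigma> B)
    from ask.IH have "\<forall>x. \<exists>S. x \<in> B \<longrightarrow>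
        barred_tree \<V> (\<lambda>\<tau>. Q ((\<sigma> @ [x]) @ \<tau>)) (\<lambda>\<tau>. P ((\<sigma> @ [x]) @ \<tau>)) S" by blast
    from choice[OF this] obtain S where
      S: "\<And>x. x \<in> B \<Longrightarrow> barred_tree \<V> (\<lambda>\<tau>. Q (\<sigma> @ x # \<tau>)) (\<lambda>\<tau>. P (\<sigma> @ x # \<tau>)) (S x)"
      by auto
    define T where "T = {[]} \<union> {x # \<tau> | x \<tau>. x \<in> B \<and> \<tau> \<in> S x}"
    have nil: "[] \<in> S x" if "x \<in> B" for x
      using S[OF that] by (simp add: barred_tree_def tree_def)
    have "tree T" unfolding tree_def
    proof (intro conjI allI impI)
      show "[] \<in> T" by (simp add: T_def)
      fix \<rho> \<tau> assume "\<tau> \<in> T" "prefix \<rho> \<tau>"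
      then show "\<rho> \<in> T" unfolding T_def
        by (cases \<rho>; cases \<tau>) (auto dest: S simp: barred_tree_def tree_def)
    qed
    moreover have "\<exists>n. P (\<sigma> @ p \<restriction> n)" if p: "p \<in> paths T" for p
    proof -
      have mem: "p 0 \<in> B \<and> (\<lambda>i. p (Suc i)) \<restriction> n \<in> S (p 0)" for n
      proof -
        have "p \<restriction> Suc n \<in> T" using p unfolding paths_def by blast
        then show ?thesis unfolding restr_Suc_shift by (auto simp: T_def)
      qed
      then have "(\<lambda>i. p (Suc i)) \<in> paths (S (p 0))" by (simp add: paths_def)
      with S mem obtain n where "P (\<sigma> @ p 0 # (\<lambda>i. p (Suc i)) \<restriction> n)"
        unfolding barred_tree_def by blast
      then show ?thesis unfolding restr_Suc_shift[symmetric] by blast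
    qed
    moreover have "P (\<sigma> @ \<tau>) \<or> Q (\<sigma> @ \<tau>) \<and> {x. \<tau> @ [x] \<in> T} \<in> \<V>" if "\<tau> \<in> T" for \<tau>
    proof (cases \<tau>)
      case Nil
      have "{x. [x] \<in> T} = B" using nil by (auto simp: T_def)
      then show ?thesis using ask.hyps Nil by simp
    next
      case (Cons x \<rho>)
      with that have x: "x \<in> B" "\<rho> \<in> S x" by (auto simp: T_def)
      then have "{y. \<tau> @ [y] \<in> T} = {y. \<rho> @ [y] \<in> S x}" by (auto simp: T_def Cons)
      with S[OF x(1)] x(2) show ?thesis by (auto simp: barred_tree_def Cons)
    qed
    ultimately show ?case unfolding barred_tree_def by blast
  qed
  from this[of "[]"] show "forces \<V> Q P [] \<Longrightarrow> \<exists>S. barred_tree \<V> Q P S" by simp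
qed

section \<open>The gamified order in terms of forcing\<close>

text \<open>
  Queries are made only where \<open>\<phi>\<close> is undefined, so the first label on a play counts and \<open>\<phi>\<close> need not
  be coherent.
\<close>
abbreviation wins :: "nat set set \<Rightarrow> (nat list \<rightharpoonup> nat) \<Rightarrow> nat set \<Rightarrow> nat list \<Rightarrow> bool" where
  "wins \<V> \<phi> A \<equiv> forces \<V> (\<lambda>\<sigma>. \<phi> \<sigma> = None) (\<lambda>\<sigma>. \<phi> \<sigma> \<in> Some ` A)"

lemma wins_defined: "wins \<V> \<phi> A \<sigma> \<Longrightarrow> \<phi> \<sigma> = Some y \<Longrightarrow> y \<in> A"
  by (erule forces.cases) auto

lemma upper_setD:
  assumes "upper_set \<U>"
  shows "\<U> \<noteq> {}" "{} \<notin> \<U>" "UNIV \<in> \<U>" "A \<in> \<U> \<Longrightarrow> A \<subseteq> B \<Longrightarrow> B \<in> \<U>"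
  using assms unfolding upper_set_def by blast+

text \<open>
  The domain of \<open>\<phi>\<close> becomes the fence in (i), hence the antichain condition. It is achieved by
  keeping only the minimal strings of the given domain.
\<close>
lemma gamified_imp_wins:
  assumes "\<U> \<le>\<^sub>L\<^sub>T\<^sup>o \<V>" "upper_set \<V>"
  obtains \<phi> where "antichain (dom \<phi>)" "\<And>A. A \<in> \<U> \<Longrightarrow> wins \<V> \<phi> A []"
proof -
  from assms(1) obtain \<Phi> where pc: "partial_continuous \<Phi>"
    and trees: "\<forall>A\<in>\<U>. \<exists>T. tree T \<and> branching \<V> T \<and>
           paths T \<subseteq> dom \<Phi> \<and> (\<forall>p\<in>paths T. the (\<Phi> p) \<in> A)"
    unfolding gamified_katetov_le_def by blast
  from pc obtain \<theta> where \<theta>: "\<And>p c. \<Phi> p = Some c \<longleftrightarrow> (\<exists>n. \<theta> (p \<restriction> n) = Some c)"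
    unfolding partial_continuous_def by blast
  define \<phi> where
    "\<phi> \<sigma> = (if \<forall>\<tau>. strict_prefix \<tau> \<sigma> \<longrightarrow> \<theta> \<tau> = None then \<theta> \<sigma> else None)" for \<sigma>
  have "antichain (dom \<phi>)"
    unfolding antichain_def pairwise_def
    by (auto simp: \<phi>_def strict_prefix_def parallel_def split: if_splits)
  moreover have "wins \<V> \<phi> A []" if "A \<in> \<U>" for A
  proof -
    from trees that obtain T where T: "tree T" "branching \<V> T" "paths T \<subseteq> dom \<Phi>"
        "\<forall>p\<in>paths T. the (\<Phi> p) \<in> A" by blast
    have "\<exists>n. \<phi> (p \<restriction> n) \<in> Some ` A" if p: "p \<in> paths T" for p
    proof -
      from p T(3,4) obtain c where c: "\<Phi> p = Some c" "c \<in> A" by fastforce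
      then have ex: "\<exists>n. \<theta> (p \<restriction> n) \<noteq> None" using \<theta> by (metis option.distinct(1))
      define n where "n = (LEAST n. \<theta> (p \<restriction> n) \<noteq> None)"
      have n: "\<theta> (p \<restriction> n) \<noteq> None" unfolding n_def by (rule LeastI_ex[OF ex])
      have "\<theta> (p \<restriction> m) = None" if "m < n" for m
        using not_less_Least that unfolding n_def by blast
      then have "\<forall>\<tau>. strict_prefix \<tau> (p \<restriction> n) \<longrightarrow> \<theta> \<tau> = None"
        unfolding strict_prefixes_restr by blast
      then have "\<phi> (p \<restriction> n) = \<theta> (p \<restriction> n)" by (simp add: \<phi>_def)
      also have "\<dots> = Some c" using n c \<theta> by (metis not_None_eq option.inject)
      finally show ?thesis using c(2) by blast
    qed
    moreover have "\<phi> \<sigma> \<in> Some ` A \<or> \<phi> \<sigma> = None \<and> {x. \<sigma> @ [x] \<in> T} \<in> \<V>" if \<sigma>: "\<sigma> \<in> T" for \<sigma>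
    proof (cases "\<phi> \<sigma>")
      case None
      then show ?thesis using T(2) \<sigma> by (auto simp: branching_def)
    next
      case (Some c)
      \<comment> \<open>The label at \<open>\<sigma>\<close> is the value of \<open>\<Phi>\<close> on any path of \<open>T\<close> through \<open>\<sigma>\<close>, and such a path
        exists because \<open>\<V>\<close> has no empty member.\<close>
      have "\<exists>x. \<tau> @ [x] \<in> T" if "\<tau> \<in> T" for \<tau>
      proof -
        have "{x. \<tau> @ [x] \<in> T} \<in> \<V>" using T(2) that unfolding branching_def by blast
        then have "{x. \<tau> @ [x] \<in> T} \<noteq> {}" using upper_setD(2)[OF assms(2)] by metis
        then show ?thesis by simp
      qed
      with \<sigma> obtain p where p: "p \<restriction> length \<sigma> = \<sigma>" "\<And>n. length \<sigma> \<le> n \<Longrightarrow> p \<restriction> n \<in> T"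
        using path_through[of "\<lambda>\<tau>. \<tau> \<in> T" \<sigma>] by blast
      have "p \<restriction> n \<in> T" for n
      proof (cases "length \<sigma> \<le> n")
        case False
        then have "prefix (p \<restriction> n) \<sigma>" using restr_prefix[of n "length \<sigma>" p] p(1) by simp
        then show ?thesis using T(1) \<sigma> unfolding tree_def by blast
      qed (rule p(2))
      then have "p \<in> paths T" by (simp add: paths_def)
      moreover have "\<theta> (p \<restriction> length \<sigma>) = Some c" using Some p(1) by (simp add: \<phi>_def split: if_splits)
      then have "\<Phi> p = Some c" using \<theta> by blast
      ultimately show ?thesis using T(4) Some by fastforce
    qed
    ultimately have "barred_tree \<V> (\<lambda>\<sigma>. \<phi> \<sigma> = None) (\<lambda>\<sigma>. \<phi> \<sigma> \<in> Some ` A) T"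
      using T(1) unfolding barred_tree_def by blast
    then show ?thesis using forces_iff_barred_tree by blast
  qed
  ultimately show ?thesis using that by blast
qed

text \<open>
  Conversely, a barred tree is made branching everywhere by attaching the full tree above each
  of its labelled nodes, which is harmless since the value of \<open>\<Phi>\<close> is settled there.
\<close>
lemma wins_imp_gamified:
  assumes "\<And>A. A \<in> \<U> \<Longrightarrow> wins \<V> \<phi> A []" "upper_set \<V>"
  shows "\<U> \<le>\<^sub>L\<^sub>T\<^sup>o \<V>"
proof -
  define \<theta> where
    "\<theta> \<sigma> = (if \<forall>\<tau>. strict_prefix \<tau> \<sigma> \<longrightarrow> \<phi> \<tau> = None then \<phi> \<sigma> else None)" for \<sigma>
  define \<Phi> where
    "\<Phi> p = (if \<exists>n. \<phi> (p \<restriction> n) \<noteq> None then \<phi> (p \<restriction> (LEAST n. \<phi> (p \<restriction> n) \<noteq> None)) else None)" for p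
  have "coherent \<theta>"
    unfolding coherent_def by (auto simp: \<theta>_def strict_prefix_def split: if_splits)
  moreover have "\<Phi> p = Some c \<longleftrightarrow> (\<exists>n. \<theta> (p \<restriction> n) = Some c)" for p c
  proof
    assume *: "\<Phi> p = Some c"
    define n where "n = (LEAST n. \<phi> (p \<restriction> n) \<noteq> None)"
    have "\<phi> (p \<restriction> m) = None" if "m < n" for m
      using not_less_Least that unfolding n_def by blast
    then have "\<forall>\<tau>. strict_prefix \<tau> (p \<restriction> n) \<longrightarrow> \<phi> \<tau> = None"
      unfolding strict_prefixes_restr by blast
    then have "\<theta> (p \<restriction> n) = Some c" using * unfolding \<theta>_def \<Phi>_def n_def by (metis option.distinct(1))
    then show "\<exists>n. \<theta> (p \<restriction> n) = Some c" ..
  next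
    assume "\<exists>n. \<theta> (p \<restriction> n) = Some c"
    then obtain n where n: "\<theta> (p \<restriction> n) = Some c" ..
    then have c: "\<phi> (p \<restriction> n) = Some c"
      and min: "\<And>\<tau>. strict_prefix \<tau> (p \<restriction> n) \<Longrightarrow> \<phi> \<tau> = None"
      by (auto simp: \<theta>_def split: if_splits)
    have "(LEAST n. \<phi> (p \<restriction> n) \<noteq> None) = n"
    proof (rule Least_equality)
      show "\<phi> (p \<restriction> n) \<noteq> None" using c by simp
      fix m assume "\<phi> (p \<restriction> m) \<noteq> None"
      show "n \<le> m"
      proof (rule ccontr)
        assume "\<not> n \<le> m"
        with min show False
          using \<open>\<phi> (p \<restriction> m) \<noteq> None\<close> strict_prefixes_restr[of p n "\<lambda>\<tau>. \<phi> \<tau> = None"] by auto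
      qed
    qed
    then show "\<Phi> p = Some c" using c by (auto simp: \<Phi>_def)
  qed
  ultimately have "partial_continuous \<Phi>" unfolding partial_continuous_def by blast
  moreover have "\<exists>T. tree T \<and> branching \<V> T \<and> paths T \<subseteq> dom \<Phi> \<and> (\<forall>p\<in>paths T. the (\<Phi> p) \<in> A)"
    if A: "A \<in> \<U>" for A
  proof -
    from assms(1)[OF A] obtain S where
      "barred_tree \<V> (\<lambda>\<sigma>. \<phi> \<sigma> = None) (\<lambda>\<sigma>. \<phi> \<sigma> \<in> Some ` A) S"
      using forces_iff_barred_tree by blast
    then have S: "tree S" "\<And>p. p \<in> paths S \<Longrightarrow> \<exists>n. \<phi> (p \<restriction> n) \<in> Some ` A"
        "\<And>\<sigma>. \<sigma> \<in> S \<Longrightarrow> \<phi> \<sigma> \<in> Some ` A \<or> \<phi> \<sigma> = None \<and> {x. \<sigma> @ [x] \<in> S} \<in> \<V>"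
      unfolding barred_tree_def by blast+
    define T where "T = S \<union> {\<sigma>. \<exists>\<tau>\<in>S. \<phi> \<tau> \<in> Some ` A \<and> prefix \<tau> \<sigma>}"
    have "tree T" unfolding tree_def
    proof (intro conjI allI impI)
      show "[] \<in> T" using S(1) by (simp add: T_def tree_def)
      fix \<rho> \<sigma> assume "\<sigma> \<in> T" "prefix \<rho> \<sigma>"
      then consider "\<sigma> \<in> S" | \<tau> where "\<tau> \<in> S" "\<phi> \<tau> \<in> Some ` A" "prefix \<tau> \<sigma>"
        by (auto simp: T_def)
      then show "\<rho> \<in> T"
      proof cases
        case 1
        then show ?thesis using S(1) \<open>prefix \<rho> \<sigma>\<close> unfolding T_def tree_def by blast
      next
        case 2
        with \<open>prefix \<rho> \<sigma>\<close> have "prefix \<rho> \<tau> \<or> prefix \<tau> \<rho>" by (metis prefix_same_cases)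
        then show ?thesis using 2 S(1) unfolding T_def tree_def by blast
      qed
    qed
    moreover have "branching \<V> T" unfolding branching_def
    proof
      fix \<sigma> assume \<sigma>: "\<sigma> \<in> T"
      show "{n. \<sigma> @ [n] \<in> T} \<in> \<V>"
      proof (cases "\<exists>\<tau>\<in>S. \<phi> \<tau> \<in> Some ` A \<and> prefix \<tau> \<sigma>")
        case True
        then have "{n. \<sigma> @ [n] \<in> T} = UNIV" by (auto simp: T_def intro: prefix_prefix)
        then show ?thesis using upper_setD(3)[OF assms(2)] by simp
      next
        case False
        with \<sigma> have "\<sigma> \<in> S" by (simp add: T_def)
        with S(3)[OF this] False have "{n. \<sigma> @ [n] \<in> S} \<in> \<V>" by blast
        then show ?thesis by (rule upper_setD(4)[OF assms(2)]) (auto simp: T_def)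
      qed
    qed
    moreover have "\<exists>c\<in>A. \<Phi> p = Some c" if p: "p \<in> paths T" for p
    proof -
      have hit: "\<exists>n. \<phi> (p \<restriction> n) \<in> Some ` A \<and> p \<restriction> n \<in> S"
      proof (cases "p \<in> paths S")
        case True
        then show ?thesis using S(2) unfolding paths_def by blast
      next
        case False
        then obtain m where "p \<restriction> m \<notin> S" by (auto simp: paths_def)
        moreover have "p \<restriction> m \<in> T" using p by (simp add: paths_def)
        ultimately obtain \<tau> where "\<tau> \<in> S" "\<phi> \<tau> \<in> Some ` A" "prefix \<tau> (p \<restriction> m)"
          by (auto simp: T_def)
        then show ?thesis using prefix_restr by metis
      qed
      then have ex: "\<exists>n. \<phi> (p \<restriction> n) \<noteq> None" by auto
      define n where "n = (LEAST n. \<phi> (p \<restriction> n) \<noteq> None)"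
      have n: "\<phi> (p \<restriction> n) \<noteq> None" unfolding n_def by (rule LeastI_ex[OF ex])
      from hit obtain k where k: "\<phi> (p \<restriction> k) \<in> Some ` A" "p \<restriction> k \<in> S" by blast
      have "n \<le> k" unfolding n_def by (rule Least_le) (use k in auto)
      with k(2) S(1) have "p \<restriction> n \<in> S" unfolding tree_def by (meson restr_prefix)
      with n S(3)[of "p \<restriction> n"] obtain c where "c \<in> A" "\<phi> (p \<restriction> n) = Some c" by auto
      with ex show ?thesis by (auto simp: \<Phi>_def n_def)
    qed
    ultimately show ?thesis by (intro exI[of _ T]) fastforce
  qed
  ultimately show ?thesis unfolding gamified_katetov_le_def by blast
qed

text \<open>
  A label at the root can be postponed by one idle query with the full set. The game
  demands a first query, and in the composition of reductions an empty block of answers would leave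
  the state unchanged.
\<close>
lemma wins_normalise:
  assumes "upper_set \<V>"
  obtains \<phi>' where "\<phi>' [] = None" "\<And>A. wins \<V> \<phi> A [] \<Longrightarrow> wins \<V> \<phi>' A []"
proof -
  define \<phi>' where "\<phi>' \<sigma> = (if \<sigma> = [] then None else case \<phi> [] of Some y \<Rightarrow> Some y | None \<Rightarrow> \<phi> \<sigma>)" for \<sigma>
  have "wins \<V> \<phi>' A []" if w: "wins \<V> \<phi> A []" for A
  proof (cases "\<phi> []")
    case None
    then show ?thesis using w by (intro forces_mono[OF w]) (auto simp: \<phi>'_def)
  next
    case (Some y)
    with w have "y \<in> A" by (rule wins_defined)
    show ?thesis
    proof (rule forces.ask)
      show "UNIV \<in> \<V>" using assms by (rule upper_setD)
      show "wins \<V> \<phi>' A ([] @ [x])" for x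
        by (rule forces.now) (simp add: \<phi>'_def Some \<open>y \<in> A\<close>)
    qed (simp add: \<phi>'_def)
  qed
  then show ?thesis using that[of \<phi>'] by (simp add: \<phi>'_def)
qed

theorem gamified_iff_wins:
  assumes "upper_set \<V>"
  shows "\<U> \<le>\<^sub>L\<^sub>T\<^sup>o \<V> \<longleftrightarrow> (\<exists>\<phi>. \<forall>A\<in>\<U>. wins \<V> \<phi> A [])"
  using gamified_imp_wins[of \<U> \<V>] wins_imp_gamified[of \<U> \<V>] assms by metis

lemma katetov_imp_gamified:
  assumes "\<U> \<le>\<^sub>K \<V>" "upper_set \<V>"
  shows "\<U> \<le>\<^sub>L\<^sub>T\<^sup>o \<V>"
proof -
  from assms(1) obtain h where h: "\<And>A. A \<in> \<U> \<Longrightarrow> h -` A \<in> \<V>"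
    unfolding katetov_le_def by blast
  define \<phi> where "\<phi> \<sigma> = (case \<sigma> of [x] \<Rightarrow> Some (h x) | _ \<Rightarrow> None)" for \<sigma>
  have "wins \<V> \<phi> A []" if "A \<in> \<U>" for A
  proof (rule forces.ask[OF _ h[OF that]])
    show "wins \<V> \<phi> A ([] @ [x])" if "x \<in> h -` A" for x
      using that by (intro forces.now) (simp add: \<phi>_def)
  qed (simp add: \<phi>_def)
  then show ?thesis using gamified_iff_wins[OF assms(2)] by blast
qed

lemma rudin_keisler_imp_katetov: "\<U> \<le>\<^sub>R\<^sub>K \<V> \<Longrightarrow> \<U> \<le>\<^sub>K \<V>"
  unfolding rudin_keisler_le_def katetov_le_def by blast

lemma gamified_refl: "upper_set \<U> \<Longrightarrow> \<U> \<le>\<^sub>L\<^sub>T\<^sup>o \<U>"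
  by (rule katetov_imp_gamified) (auto simp: katetov_le_def intro: exI[of _ id])

text \<open>
  To compose, a query of \<open>\<phi>\<close> is answered by a complete run of \<open>\<theta>\<close>. The state \<open>(ys, \<tau>)\<close> splits the
  string read so far: \<open>ys\<close> are the outputs of the finished runs of \<open>\<theta>\<close>, which serve as answers
  to \<open>\<phi>\<close>, and \<open>\<tau>\<close> is the unfinished run. The proof is an induction on the
  play of \<open>\<phi>\<close>, with an inner induction on the current run of \<open>\<theta>\<close>.
\<close>
theorem gamified_trans:
  assumes "\<U> \<le>\<^sub>L\<^sub>T\<^sup>o \<V>" "\<V> \<le>\<^sub>L\<^sub>T\<^sup>o \<W>" "upper_set \<V>" "upper_set \<W>"
  shows "\<U> \<le>\<^sub>L\<^sub>T\<^sup>o \<W>"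
proof -
  from assms(1,3) obtain \<phi> where \<phi>: "\<And>A. A \<in> \<U> \<Longrightarrow> wins \<V> \<phi> A []"
    using gamified_iff_wins by metis
  from assms(2,4) obtain \<theta>' where "\<And>B. B \<in> \<V> \<Longrightarrow> wins \<W> \<theta>' B []"
    using gamified_iff_wins by metis
  moreover obtain \<theta> where \<theta>0: "\<theta> [] = None" "\<And>B. wins \<W> \<theta>' B [] \<Longrightarrow> wins \<W> \<theta> B []"
    using wins_normalise[OF assms(4), of \<theta>'] by blast
  ultimately have \<theta>: "\<And>B. B \<in> \<V> \<Longrightarrow> wins \<W> \<theta> B []" by blast
  define read where "read = (\<lambda>(ys, \<tau>) x.
    case \<theta> (\<tau> @ [x]) of None \<Rightarrow> (ys, \<tau> @ [x]) | Some v \<Rightarrow> (ys @ [v], []))"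
  define state where "state = foldl read ([], [])"
  have state: "state [] = ([], [])" "state (\<sigma> @ [x]) = read (state \<sigma>) x" for \<sigma> x
    by (simp_all add: state_def)
  define \<chi> where "\<chi> \<sigma> = \<phi> (fst (state \<sigma>))" for \<sigma>
  have "wins \<W> \<chi> A \<sigma>" if "wins \<V> \<phi> A ys" "state \<sigma> = (ys, [])" for A ys \<sigma>
    using that
  proof (induction arbitrary: \<sigma>)
    case (now ys)
    then show ?case by (intro forces.now) (simp add: \<chi>_def)
  next
    case (ask ys B)
    have "wins \<W> \<chi> A \<sigma>" if "wins \<W> \<theta> B \<tau>" "state \<sigma> = (ys, \<tau>)" "\<theta> \<tau> = None" for \<tau> \<sigma>
      using that
    proof (induction arbitrary: \<sigma>)
      case (now \<tau>)
      then show ?case by auto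
    next
      case (ask \<tau> C)
      show ?case
      proof (rule forces.ask)
        show "\<chi> \<sigma> = None" using ask.prems \<open>\<phi> ys = None\<close> by (simp add: \<chi>_def)
        show "C \<in> \<W>" by fact
        fix x assume x: "x \<in> C"
        show "wins \<W> \<chi> A (\<sigma> @ [x])"
        proof (cases "\<theta> (\<tau> @ [x])")
          case None
          then show ?thesis using x ask.prems by (intro ask.IH) (auto simp: state read_def)
        next
          case (Some v)
          have "v \<in> B" using ask.hyps(3)[OF x] Some by (rule wins_defined)
          then show ?thesis
            using Some ask.prems \<open>\<And>x \<sigma>. x \<in> B \<Longrightarrow> state \<sigma> = (ys @ [x], []) \<Longrightarrow> wins \<W> \<chi> A \<sigma>\<close>
            by (auto simp: state read_def)
        qed
      qed
    qed
    from this[OF \<theta>[OF \<open>B \<in> \<V>\<close>] ask.prems \<theta>0(1)] show ?case .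
  qed
  then have "wins \<W> \<chi> A []" if "A \<in> \<U>" for A
    using \<phi>[OF that] state(1) by blast
  then show ?thesis using gamified_iff_wins[OF assms(4)] by blast
qed

section \<open>Fences and Fubini products\<close>

text \<open>
  Fence and labelling determine each other: \<open>\<delta>\<close> is the domain of \<open>\<phi>\<close>, and \<open>\<phi>\<close> is \<open>h\<close> read through the coding
  of strings. A tree barred by labels in \<open>A\<close> is then the same as a tree that is \<open>\<V>\<close>-branching
  up to \<open>\<delta>\<close> and meets \<open>\<delta>\<close> only in strings whose codes \<open>h\<close> sends into \<open>A\<close>.
\<close>
theorem gamified_iff_fence:
  assumes "upper_set \<U>" "upper_set \<V>"
  shows "\<U> \<le>\<^sub>L\<^sub>T\<^sup>o \<V> \<longleftrightarrow> (\<exists>\<delta>. fence \<V> \<delta> \<and> \<U> \<le>\<^sub>K fubini_power \<V> \<delta>)"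
proof
  assume "\<U> \<le>\<^sub>L\<^sub>T\<^sup>o \<V>"
  then obtain \<phi> where \<phi>: "antichain (dom \<phi>)" "\<And>A. A \<in> \<U> \<Longrightarrow> wins \<V> \<phi> A []"
    using gamified_imp_wins assms(2) by blast
  have tree: "\<exists>T. branching_up_to \<V> (dom \<phi>) T \<and> (\<forall>\<sigma>\<in>T \<inter> dom \<phi>. the (\<phi> \<sigma>) \<in> A)"
    if "A \<in> \<U>" for A
  proof -
    from \<phi>(2)[OF that] obtain T where
      T: "barred_tree \<V> (\<lambda>\<sigma>. \<phi> \<sigma> = None) (\<lambda>\<sigma>. \<phi> \<sigma> \<in> Some ` A) T"
      using forces_iff_barred_tree by blast
    then have "branching_up_to \<V> (dom \<phi>) T"
      unfolding barred_tree_def branching_up_to_def by blast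
    moreover have "\<forall>\<sigma>\<in>T \<inter> dom \<phi>. the (\<phi> \<sigma>) \<in> A"
      using T unfolding barred_tree_def by fastforce
    ultimately show ?thesis by blast
  qed
  have "fence \<V> (dom \<phi>)"
    using \<phi>(1) tree upper_setD(3)[OF assms(1)] unfolding fence_def by blast
  moreover have "(\<lambda>n. the (\<phi> (list_decode n))) -` A \<in> fubini_power \<V> (dom \<phi>)" if "A \<in> \<U>" for A
    using tree[OF that] unfolding fubini_power_def by fastforce
  then have "\<U> \<le>\<^sub>K fubini_power \<V> (dom \<phi>)" unfolding katetov_le_def by blast
  ultimately show "\<exists>\<delta>. fence \<V> \<delta> \<and> \<U> \<le>\<^sub>K fubini_power \<V> \<delta>" by blast
next
  assume "\<exists>\<delta>. fence \<V> \<delta> \<and> \<U> \<le>\<^sub>K fubini_power \<V> \<delta>"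
  then obtain \<delta> h where h: "\<And>A. A \<in> \<U> \<Longrightarrow> h -` A \<in> fubini_power \<V> \<delta>"
    unfolding katetov_le_def by blast
  define \<phi> where "\<phi> \<sigma> = (if \<sigma> \<in> \<delta> then Some (h (list_encode \<sigma>)) else None)" for \<sigma>
  have "wins \<V> \<phi> A []" if "A \<in> \<U>" for A
  proof -
    from h[OF that] obtain T where
      T: "branching_up_to \<V> \<delta> T" "list_encode ` (T \<inter> \<delta>) \<subseteq> h -` A"
      unfolding fubini_power_def by blast
    have out: "\<phi> \<sigma> \<in> Some ` A" if "\<sigma> \<in> T" "\<sigma> \<in> \<delta>" for \<sigma>
      using T(2) that by (auto simp: \<phi>_def)
    have "\<exists>n. \<phi> (p \<restriction> n) \<in> Some ` A" if "p \<in> paths T" for p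
      using that T(1) out unfolding branching_up_to_def paths_def by blast
    moreover have "\<phi> \<sigma> \<in> Some ` A \<or> \<phi> \<sigma> = None \<and> {x. \<sigma> @ [x] \<in> T} \<in> \<V>" if "\<sigma> \<in> T" for \<sigma>
      using that T(1) out unfolding branching_up_to_def by (cases "\<sigma> \<in> \<delta>") (auto simp: \<phi>_def)
    ultimately have "barred_tree \<V> (\<lambda>\<sigma>. \<phi> \<sigma> = None) (\<lambda>\<sigma>. \<phi> \<sigma> \<in> Some ` A) T"
      using T(1) unfolding barred_tree_def branching_up_to_def by blast
    then show ?thesis using forces_iff_barred_tree by blast
  qed
  then show "\<U> \<le>\<^sub>L\<^sub>T\<^sup>o \<V>" using gamified_iff_wins[OF assms(2)] by blast
qed

lemma mem_fubini_product:
  "A \<in> \<U> \<otimes> \<V> \<longleftrightarrow> {m. {l. prod_encode (m, l) \<in> A} \<in> \<V>} \<in> \<U>"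
proof -
  have eq: "A = prod_encode ` {p. prod_encode p \<in> A}"
  proof
    show "A \<subseteq> prod_encode ` {p. prod_encode p \<in> A}"
    proof
      fix n assume "n \<in> A"
      then show "n \<in> prod_encode ` {p. prod_encode p \<in> A}"
        by (intro image_eqI[of _ _ "prod_decode n"]) simp_all
    qed
  qed auto
  have "prod_encode ` B \<in> \<U> \<otimes> \<V> \<longleftrightarrow> B \<in> fubini_product_pairs \<U> \<V>" for B
    unfolding fubini_product_def using inj_prod_encode by (auto simp: inj_image_eq_iff)
  from this[of "{p. prod_encode p \<in> A}"] show ?thesis
    by (simp add: fubini_product_pairs_def flip: eq)
qed

lemma upper_set_fubini_product:
  assumes "upper_set \<U>" "upper_set \<V>"
  shows "upper_set (\<U> \<otimes> \<V>)"
  unfolding upper_set_def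
proof (intro conjI allI impI)
  have "UNIV \<in> \<U> \<otimes> \<V>" using assms by (simp add: mem_fubini_product upper_setD(3))
  then show "\<U> \<otimes> \<V> \<noteq> {}" by blast
  show "{} \<notin> \<U> \<otimes> \<V>" using assms by (simp add: mem_fubini_product upper_setD(2))
  fix A B assume A: "A \<in> \<U> \<otimes> \<V>" and "A \<subseteq> B"
  have "{l. prod_encode (m, l) \<in> B} \<in> \<V>" if "{l. prod_encode (m, l) \<in> A} \<in> \<V>" for m
    by (rule upper_setD(4)[OF assms(2) that]) (use \<open>A \<subseteq> B\<close> in blast)
  with A show "B \<in> \<U> \<otimes> \<V>"
    unfolding mem_fubini_product by (elim upper_setD(4)[OF assms(1)]) blast
qed

lemma gamified_fubini_square_le:
  assumes "upper_set \<U>"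
  shows "\<U> \<otimes> \<U> \<le>\<^sub>L\<^sub>T\<^sup>o \<U>"
proof -
  define \<phi> where "\<phi> \<sigma> = (case \<sigma> of [m, l] \<Rightarrow> Some (prod_encode (m, l)) | _ \<Rightarrow> None)" for \<sigma>
  have \<phi>: "\<phi> [] = None" "\<phi> [m] = None" "\<phi> [m, l] = Some (prod_encode (m, l))" for m l
    by (simp_all add: \<phi>_def)
  have "wins \<U> \<phi> A []" if A: "A \<in> \<U> \<otimes> \<U>" for A
  proof (rule forces.ask)
    show "{m. {l. prod_encode (m, l) \<in> A} \<in> \<U>} \<in> \<U>" using A by (simp add: mem_fubini_product)
    fix m assume "m \<in> {m. {l. prod_encode (m, l) \<in> A} \<in> \<U>}"
    then have "{l. prod_encode (m, l) \<in> A} \<in> \<U>" by simp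
    then show "wins \<U> \<phi> A ([] @ [m])"
    proof (rule forces.ask[rotated])
      show "wins \<U> \<phi> A (([] @ [m]) @ [l])" if "l \<in> {l. prod_encode (m, l) \<in> A}" for l
        using that by (intro forces.now) (simp add: \<phi>)
    qed (simp add: \<phi>)
  qed (simp add: \<phi>)
  then show ?thesis using gamified_iff_wins[OF assms] by blast
qed

lemma katetov_fubini_square:
  assumes "upper_set \<U>"
  shows "\<U> \<le>\<^sub>K \<U> \<otimes> \<U>"
proof -
  have "(\<lambda>n. fst (prod_decode n)) -` A \<in> \<U> \<otimes> \<U>" if "A \<in> \<U>" for A
  proof -
    have "{m. {l. m \<in> A} \<in> \<U>} = A"
      using upper_setD[OF assms] by auto
    then show ?thesis using that by (simp add: mem_fubini_product)
  qed
  then show ?thesis unfolding katetov_le_def by blast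
qed

theorem gamified_fubini_square:
  assumes "upper_set \<U>"
  shows "\<U> \<equiv>\<^sub>L\<^sub>T\<^sup>o \<U> \<otimes> \<U>"
  using assms unfolding gamified_katetov_equiv_def
  by (intro conjI katetov_imp_gamified katetov_fubini_square gamified_fubini_square_le
      upper_set_fubini_product)

text \<open>
  A reduction \<open>h\<close> to the sets meeting \<open>{0, 1}\<close> would place one of \<open>h 0\<close>, \<open>h 1\<close> in every member of
  \<open>\<U> \<otimes> \<U>\<close>; but the singletons of the codes of pairs over \<open>{0, 1}\<close> are members.
\<close>
lemma fubini_square_not_katetov:
  obtains \<U> where "upper_set \<U>" "\<not> \<U> \<otimes> \<U> \<le>\<^sub>K \<U>"
proof -
  define \<U> where "\<U> = {A :: nat set. 0 \<in> A \<or> 1 \<in> A}"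
  have "upper_set \<U>" unfolding upper_set_def \<U>_def by auto
  moreover have "\<not> \<U> \<otimes> \<U> \<le>\<^sub>K \<U>"
  proof
    assume "\<U> \<otimes> \<U> \<le>\<^sub>K \<U>"
    then obtain h where h: "\<And>A. A \<in> \<U> \<otimes> \<U> \<Longrightarrow> h -` A \<in> \<U>"
      unfolding katetov_le_def by blast
    have "prod_encode (i, j) \<in> {h 0, h 1}" if "i \<le> 1" "j \<le> 1" for i j
      using that h[of "{prod_encode (i, j)}"] unfolding mem_fubini_product \<U>_def
      by (auto simp: le_Suc_eq)
    \<comment> \<open>Three of the four pairs already exceed the two available values.\<close>
    then have "prod_encode ` {(0, 0), (0, 1), (1, 0)} \<subseteq> {h 0, h 1}" by auto
    then have "card (prod_encode ` {(0, 0), (0, 1), (1, 0)}) \<le> card {h 0, h 1}"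
      by (intro card_mono) auto
    also have "\<dots> \<le> 2" by (simp add: card_insert_if)
    finally show False by (simp add: card_image inj_prod_encode)
  qed
  ultimately show ?thesis using that by blast
qed

theorem strictly_coarser_katetov: "strictly_coarser (\<le>\<^sub>L\<^sub>T\<^sup>o) (\<le>\<^sub>K)"
proof -
  obtain \<U> where "upper_set \<U>" "\<not> \<U> \<otimes> \<U> \<le>\<^sub>K \<U>" by (rule fubini_square_not_katetov)
  then show ?thesis
    unfolding strictly_coarser_def
    using katetov_imp_gamified gamified_fubini_square_le upper_set_fubini_product by blast
qed

theorem strictly_coarser_rudin_keisler: "strictly_coarser (\<le>\<^sub>L\<^sub>T\<^sup>o) (\<le>\<^sub>R\<^sub>K)"
  using strictly_coarser_katetov rudin_keisler_imp_katetov
  unfolding strictly_coarser_def by blast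

section \<open>The finite-query game\<close>

lemma output_not_query [simp]: "prod_encode (Suc 0, y) \<noteq> 0"
proof
  assume "prod_encode (Suc 0, y) = 0"
  also have "0 = prod_encode (0, 0)" by (simp add: prod_encode_def)
  finally show False by simp
qed

lemma position_prefix: "position \<psi> \<eta> A (\<sigma> @ \<tau>) \<Longrightarrow> position \<psi> \<eta> A \<sigma>"
proof (induction \<tau> rule: rev_induct)
  case (snoc x \<tau>)
  from snoc.prems have "position \<psi> \<eta> A (\<sigma> @ \<tau>)"
    by (cases rule: position.cases) (auto simp flip: append_assoc)
  then show ?case by (rule snoc.IH)
qed simp

lemma position_snocD:
  assumes "position \<psi> \<eta> A (\<sigma> @ [x])"
  obtains B where "\<psi> \<sigma> = Some 0" "\<eta> (A, \<sigma>) = Some B" "x \<in> B"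
  using assms by (cases rule: position.cases) auto

abbreviation game_forces ::
    "nat set set \<Rightarrow> (nat list \<rightharpoonup> nat) \<Rightarrow> nat set \<Rightarrow> nat list \<Rightarrow> bool" where
  "game_forces \<V> \<psi> A \<equiv>
     forces \<V> (\<lambda>\<sigma>. \<psi> \<sigma> = Some 0) (\<lambda>\<sigma>. \<exists>y\<in>A. \<psi> \<sigma> = Some (prod_encode (1, y)))"

text \<open>
  For a fixed \<open>\<psi>\<close>, the legal positions of a winning strategy form a tree without infinite paths;
  conversely \<open>\<eta>\<close> offers the successors in a barred tree chosen for \<open>A\<close>. No infinite play
  follows this \<open>\<eta>\<close>: it would meet an output, and an output is not a query.
\<close>
theorem winning_strategy_iff_forces:
  "(\<exists>\<eta>. winning_strategy \<U> \<V> \<psi> \<eta>) \<longleftrightarrow>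
     \<psi> [] = Some 0 \<and> (\<forall>A\<in>\<U>. game_forces \<V> \<psi> A [])"
proof
  assume "\<exists>\<eta>. winning_strategy \<U> \<V> \<psi> \<eta>"
  then obtain \<eta> where "winning_strategy \<U> \<V> \<psi> \<eta>" ..
  then have start: "\<psi> [] = Some 0" and
    legal: "\<And>A \<sigma>. A \<in> \<U> \<Longrightarrow> position \<psi> \<eta> A \<sigma> \<Longrightarrow>
        (\<psi> \<sigma> = Some 0 \<and> (\<exists>B\<in>\<V>. \<eta> (A, \<sigma>) = Some B)) \<or>
        (\<exists>y\<in>A. \<psi> \<sigma> = Some (prod_encode (1, y)))" and
    fin: "\<And>A x. A \<in> \<U> \<Longrightarrow> \<exists>n. \<not> position \<psi> \<eta> A (x \<restriction> n)"
    unfolding winning_strategy_def by blast+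
  have "game_forces \<V> \<psi> A []" if A: "A \<in> \<U>" for A
  proof -
    let ?S = "{\<sigma>. position \<psi> \<eta> A \<sigma>}"
    have "tree ?S"
      unfolding tree_def by (auto intro: position.start elim: position_prefix simp: prefix_def)
    moreover have "paths ?S = {}" using fin[OF A] by (auto simp: paths_def)
    moreover have "(\<exists>y\<in>A. \<psi> \<sigma> = Some (prod_encode (1, y))) \<or>
        \<psi> \<sigma> = Some 0 \<and> {x. \<sigma> @ [x] \<in> ?S} \<in> \<V>" if \<sigma>: "\<sigma> \<in> ?S" for \<sigma>
    proof -
      have "{x. \<sigma> @ [x] \<in> ?S} = B" if "\<psi> \<sigma> = Some 0" "\<eta> (A, \<sigma>) = Some B" for B
        using that \<sigma> by (auto intro: position.reply elim: position_snocD)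
      then show ?thesis using legal[OF A] \<sigma> by (metis mem_Collect_eq)
    qed
    ultimately show ?thesis
      unfolding forces_iff_barred_tree barred_tree_def by blast
  qed
  with start show "\<psi> [] = Some 0 \<and> (\<forall>A\<in>\<U>. game_forces \<V> \<psi> A [])" by blast
next
  assume rhs: "\<psi> [] = Some 0 \<and> (\<forall>A\<in>\<U>. game_forces \<V> \<psi> A [])"
  then have "\<forall>A. \<exists>S. A \<in> \<U> \<longrightarrow> barred_tree \<V> (\<lambda>\<sigma>. \<psi> \<sigma> = Some 0)
      (\<lambda>\<sigma>. \<exists>y\<in>A. \<psi> \<sigma> = Some (prod_encode (1, y))) S"
    using forces_iff_barred_tree by blast
  from choice[OF this] obtain S where
    "\<And>A. A \<in> \<U> \<Longrightarrow> barred_tree \<V> (\<lambda>\<sigma>. \<psi> \<sigma> = Some 0)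
      (\<lambda>\<sigma>. \<exists>y\<in>A. \<psi> \<sigma> = Some (prod_encode (1, y))) (S A)" by blast
  then have S: "\<And>A. A \<in> \<U> \<Longrightarrow> [] \<in> S A"
    "\<And>A p. A \<in> \<U> \<Longrightarrow> p \<in> paths (S A) \<Longrightarrow>
        \<exists>n. \<exists>y\<in>A. \<psi> (p \<restriction> n) = Some (prod_encode (1, y))"
    "\<And>A \<sigma>. A \<in> \<U> \<Longrightarrow> \<sigma> \<in> S A \<Longrightarrow> (\<exists>y\<in>A. \<psi> \<sigma> = Some (prod_encode (1, y))) \<or>
        \<psi> \<sigma> = Some 0 \<and> {x. \<sigma> @ [x] \<in> S A} \<in> \<V>"
    unfolding barred_tree_def tree_def by blast+
  define \<eta> where "\<eta> = (\<lambda>(A, \<sigma>). Some {x. \<sigma> @ [x] \<in> S A})"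
  have pos: "\<sigma> \<in> S A" if "position \<psi> \<eta> A \<sigma>" "A \<in> \<U>" for A \<sigma>
    using that by induction (auto simp: \<eta>_def S(1))
  have "\<not> (\<exists>x. \<forall>n. position \<psi> \<eta> A (x \<restriction> n))" if A: "A \<in> \<U>" for A
  proof
    assume "\<exists>x. \<forall>n. position \<psi> \<eta> A (x \<restriction> n)"
    then obtain x where x: "\<And>n. position \<psi> \<eta> A (x \<restriction> n)" by blast
    then have "x \<in> paths (S A)" using pos A by (simp add: paths_def)
    with S(2)[OF A] obtain n y where n: "\<psi> (x \<restriction> n) = Some (prod_encode (1, y))" by blast
    from x[of "Suc n"] have "\<psi> (x \<restriction> n) = Some 0"
      unfolding restr_Suc by (rule position_snocD)
    with n show False by simp
  qed
  moreover have "(\<psi> \<sigma> = Some 0 \<and> (\<exists>B\<in>\<V>. \<eta> (A, \<sigma>) = Some B)) \<or>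
        (\<exists>y\<in>A. \<psi> \<sigma> = Some (prod_encode (1, y)))" if "A \<in> \<U>" "position \<psi> \<eta> A \<sigma>" for A \<sigma>
    using S(3)[OF that(1) pos[OF that(2,1)]] by (auto simp: \<eta>_def)
  ultimately have "winning_strategy \<U> \<V> \<psi> \<eta>"
    using rhs unfolding winning_strategy_def by blast
  then show "\<exists>\<eta>. winning_strategy \<U> \<V> \<psi> \<eta>" by blast
qed

theorem gamified_iff_player_II_wins:
  assumes "upper_set \<V>"
  shows "\<U> \<le>\<^sub>L\<^sub>T\<^sup>o \<V> \<longleftrightarrow> player_II_wins \<U> \<V>"
proof
  assume "\<U> \<le>\<^sub>L\<^sub>T\<^sup>o \<V>"
  then obtain \<phi>' where \<phi>': "\<And>A. A \<in> \<U> \<Longrightarrow> wins \<V> \<phi>' A []"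
    using gamified_iff_wins[OF assms] by blast
  obtain \<phi> where \<phi>: "\<phi> [] = None" "\<And>A. wins \<V> \<phi>' A [] \<Longrightarrow> wins \<V> \<phi> A []"
    using wins_normalise[OF assms, of \<phi>'] by blast
  define \<psi> where
    "\<psi> \<sigma> = Some (case \<phi> \<sigma> of None \<Rightarrow> 0 | Some y \<Rightarrow> prod_encode (1, y))" for \<sigma>
  have "game_forces \<V> \<psi> A []" if "A \<in> \<U>" for A
    by (rule forces_mono[OF \<phi>(2)[OF \<phi>'[OF that]]]) (auto simp: \<psi>_def)
  then have "\<exists>\<eta>. winning_strategy \<U> \<V> \<psi> \<eta>"
    unfolding winning_strategy_iff_forces by (simp add: \<psi>_def \<phi>(1))
  then show "player_II_wins \<U> \<V>" unfolding player_II_wins_def by blast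
next
  assume "player_II_wins \<U> \<V>"
  then obtain \<psi> where "\<exists>\<eta>. winning_strategy \<U> \<V> \<psi> \<eta>" unfolding player_II_wins_def by blast
  then have \<psi>: "\<And>A. A \<in> \<U> \<Longrightarrow> game_forces \<V> \<psi> A []"
    unfolding winning_strategy_iff_forces by blast
  define \<phi> where
    "\<phi> \<sigma> = (if \<psi> \<sigma> = Some 0 then None else map_option (\<lambda>n. snd (prod_decode n)) (\<psi> \<sigma>))" for \<sigma>
  have "wins \<V> \<phi> A []" if "A \<in> \<U>" for A
    by (rule forces_mono[OF \<psi>[OF that]]) (auto simp: \<phi>_def)
  then show "\<U> \<le>\<^sub>L\<^sub>T\<^sup>o \<V>" using gamified_iff_wins[OF assms] by blast
qed

section \<open>Computable functions on natural numbers\<close>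

abbreviation code_pair :: "nat \<Rightarrow> nat \<Rightarrow> nat" ("\<langle>_,/ _\<rangle>") where
  "\<langle>a, b\<rangle> \<equiv> prod_encode (a, b)"

abbreviation pair_left :: "nat \<Rightarrow> nat" ("\<pi>\<^sub>1") where
  "\<pi>\<^sub>1 n \<equiv> fst (prod_decode n)"

abbreviation pair_right :: "nat \<Rightarrow> nat" ("\<pi>\<^sub>2") where
  "\<pi>\<^sub>2 n \<equiv> snd (prod_decode n)"

lemma phi_encode_code [simp]: "phi (encode_code c) = eval_code c"
  by (simp add: phi_def inv_f_f[OF inj_encode_code])

lemma encode_code_cases: obtains c where "e = encode_code c"
  using surj_encode_code by (metis surj_def)

text \<open>
  Totality makes closure under composition and primitive recursion plain equations. Partial
  functions are treated below through their indices.
\<close>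
definition computable :: "(nat \<Rightarrow> nat) \<Rightarrow> bool" where
  "computable f \<longleftrightarrow> (\<exists>e. \<forall>a. phi e a = Some (f a))"

lemma computableI: "(\<And>a. eval_code c a = Some (f a)) \<Longrightarrow> computable f"
  unfolding computable_def by (metis phi_encode_code)

lemma computableE:
  assumes "computable f"
  obtains c where "\<And>a. eval_code c a = Some (f a)"
  using assms unfolding computable_def by (metis encode_code_cases phi_encode_code)

lemma computable_id: "computable (\<lambda>x. x)"
  by (rule computableI[of "Tuple Proj1 Proj2"]) simp

lemma computable_comp:
  assumes "computable g" "computable f"
  shows "computable (\<lambda>x. g (f x))"
proof -
  obtain c where "\<And>a. eval_code c a = Some (g a)" using assms(1) by (rule computableE) blast
  moreover obtain d where "\<And>a. eval_code d a = Some (f a)"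
    using assms(2) by (rule computableE) blast
  ultimately show ?thesis by (intro computableI[of "Comp c d"]) simp
qed

lemma computable_Suc: "computable f \<Longrightarrow> computable (\<lambda>x. Suc (f x))"
  by (rule computable_comp[of Suc]) (auto intro: computableI[of Succ])

lemma computable_left: "computable f \<Longrightarrow> computable (\<lambda>x. \<pi>\<^sub>1 (f x))"
  by (rule computable_comp[of "\<lambda>n. \<pi>\<^sub>1 n"]) (auto intro: computableI[of Proj1])

lemma computable_right: "computable f \<Longrightarrow> computable (\<lambda>x. \<pi>\<^sub>2 (f x))"
  by (rule computable_comp[of "\<lambda>n. \<pi>\<^sub>2 n"]) (auto intro: computableI[of Proj2])

lemma computable_const: "computable (\<lambda>x. n)"
proof (induction n)
  case 0 show ?case by (rule computableI[of Zero]) simp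
next
  case (Suc n) then show ?case by (rule computable_Suc)
qed

lemma computable_pair:
  assumes "computable f" "computable g"
  shows "computable (\<lambda>x. \<langle>f x, g x\<rangle>)"
proof -
  obtain c where "\<And>a. eval_code c a = Some (f a)" using assms(1) by (rule computableE) blast
  moreover obtain d where "\<And>a. eval_code d a = Some (g a)"
    using assms(2) by (rule computableE) blast
  ultimately show ?thesis by (intro computableI[of "Tuple c d"]) simp
qed

lemma computable_rec:
  assumes "computable f" "computable (\<lambda>x. g (\<pi>\<^sub>1 x) (\<pi>\<^sub>1 (\<pi>\<^sub>2 x)) (\<pi>\<^sub>2 (\<pi>\<^sub>2 x)))" "computable n"
  shows "computable (\<lambda>x. rec_nat (f x) (g x) (n x))"
proof -
  obtain c where c: "\<And>a. eval_code c a = Some (f a)" using assms(1) by (rule computableE) blast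
  obtain d where d: "\<And>x. eval_code d x = Some (g (\<pi>\<^sub>1 x) (\<pi>\<^sub>1 (\<pi>\<^sub>2 x)) (\<pi>\<^sub>2 (\<pi>\<^sub>2 x)))"
    using assms(2) by (rule computableE) blast
  have "eval_code (Prec c d) \<langle>a, k\<rangle> = Some (rec_nat (f a) (g a) k)" for a k
    by (induction k) (simp_all add: c d)
  moreover have "computable (\<lambda>x. \<langle>x, n x\<rangle>)"
    using assms(3) by (intro computable_pair computable_id)
  then obtain e where "\<And>a. eval_code e a = Some \<langle>a, n a\<rangle>"
    by (rule computableE) blast
  ultimately show ?thesis
    by (intro computableI[of "Comp (Prec c d) e"]) (simp del: eval_code.simps(7))
qed

lemmas computable_basic =
  computable_id computable_const computable_Suc computable_left computable_right computable_pair

lemma computable_add: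
  assumes "computable f" "computable g"
  shows "computable (\<lambda>x. f x + g x)"
proof -
  have "rec_nat a (\<lambda>k r. Suc r) n = a + n" for a n by (induction n) auto
  then have "(\<lambda>x. f x + g x) = (\<lambda>x. rec_nat (f x) (\<lambda>k r. Suc r) (g x))" by simp
  then show ?thesis using assms by (auto intro!: computable_rec computable_basic)
qed

lemma computable_times4:
  assumes "computable f"
  shows "computable (\<lambda>x. 4 * f x)"
proof -
  have "(\<lambda>x. 4 * f x) = (\<lambda>x. (f x + f x) + (f x + f x))" by auto
  then show ?thesis using assms by (simp only: computable_add)
qed

lemma computable_diff:
  assumes "computable f" "computable g"
  shows "computable (\<lambda>x. f x - g x)"
proof -
  have pred: "rec_nat 0 (\<lambda>k r. k) n = n - 1" for n by (cases n) auto
  have "computable (\<lambda>x. rec_nat 0 (\<lambda>k r. k) (\<pi>\<^sub>2 (\<pi>\<^sub>2 x)))"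
    by (intro computable_rec computable_basic)
  then have *: "computable (\<lambda>x. \<pi>\<^sub>2 (\<pi>\<^sub>2 x) - 1)" by (simp add: pred)
  have "rec_nat a (\<lambda>k r. r - 1) n = a - n" for a n :: nat by (induction n) auto
  then have "(\<lambda>x. f x - g x) = (\<lambda>x. rec_nat (f x) (\<lambda>k r. r - 1) (g x))" by simp
  then show ?thesis using assms * by (auto intro!: computable_rec)
qed

lemma computable_if_eq:
  assumes "computable f" "computable g" "computable h" "computable k"
  shows "computable (\<lambda>x. if f x = g x then h x else k x)"
proof -
  have "(\<lambda>x. if f x = g x then h x else k x) =
      (\<lambda>x. rec_nat (h x) (\<lambda>i r. k x) ((f x - g x) + (g x - f x)))" (is "_ = (\<lambda>x. ?r x)")
  proof
    fix x
    show "(if f x = g x then h x else k x) = ?r x"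
      by (cases "(f x - g x) + (g x - f x)") auto
  qed
  moreover have "computable (\<lambda>x. k (\<pi>\<^sub>1 x))"
    by (rule computable_comp[OF assms(4)]) (intro computable_basic)
  ultimately show ?thesis
    using assms by (auto intro!: computable_rec computable_add computable_diff)
qed

lemma computable_mod4: "computable f \<Longrightarrow> computable (\<lambda>x. f x mod 4)"
proof -
  assume f: "computable f"
  have "rec_nat 0 (\<lambda>k r. if r = 3 then 0 else Suc r) n = n mod 4" for n :: nat
    by (induction n) (auto simp: mod_Suc)
  then have "(\<lambda>x. f x mod 4) = (\<lambda>x. rec_nat 0 (\<lambda>k r. if r = 3 then 0 else Suc r) (f x))" by simp
  then show ?thesis using f by (auto intro!: computable_rec computable_if_eq computable_basic)
qed

lemma computable_div4: "computable f \<Longrightarrow> computable (\<lambda>x. f x div 4)"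
proof -
  assume f: "computable f"
  have "rec_nat 0 (\<lambda>k r. if k mod 4 = 3 then Suc r else r) n = n div 4" for n :: nat
    by (induction n) (auto simp: div_Suc mod_Suc)
  then have "(\<lambda>x. f x div 4) = (\<lambda>x. rec_nat 0 (\<lambda>k r. if k mod 4 = 3 then Suc r else r) (f x))"
    by simp
  then show ?thesis
    using f by (auto intro!: computable_rec computable_if_eq computable_basic computable_mod4)
qed

lemmas computable_intros = computable_basic computable_if_eq
  computable_add computable_times4 computable_diff computable_mod4 computable_div4

section \<open>A universal function\<close>

text \<open>
  A state of the machine is a pair of a current value and a stack; the stack is \<open>0\<close> when
  empty. The frames are:
    \<^item> \<open>\<langle>0, c\<rangle>\<close>: run the program with number \<open>c\<close> on the current value;
    \<^item> \<open>\<langle>1, \<langle>g, a\<rangle>\<rangle>\<close> and \<open>\<langle>2, x\<rangle>\<close>: the first component of a \<open>Tuple\<close> is being computed, with \<open>g\<close> still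
      to be run on \<open>a\<close>; or the second one is, the first being \<open>x\<close>;
    \<^item> \<open>\<langle>3, \<langle>g, \<langle>b, \<langle>k, n\<rangle>\<rangle>\<rangle>\<rangle>\<close>: the value of a \<open>Prec\<close> at \<open>\<langle>b, k\<rangle>\<close> is being computed and \<open>n\<close> rounds remain
      after it;
    \<^item> \<open>\<langle>4, \<langle>f, \<langle>a, k\<rangle>\<rangle>\<rangle>\<close>: a \<open>Mu\<close> is testing the candidate \<open>k\<close>.

  A single step involves neither loops nor recursion, so its computability is immediate; all
  recursion of the evaluator goes into iterating the step.
\<close>
abbreviation push :: "nat \<Rightarrow> nat \<Rightarrow> nat \<Rightarrow> nat" where
  "push tag d s \<equiv> Suc \<langle>\<langle>tag, d\<rangle>, s\<rangle>"

definition start_step :: "nat \<Rightarrow> nat \<Rightarrow> nat \<Rightarrow> nat" where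
  "start_step c v s =
    (if c = 0 then \<langle>0, s\<rangle>
     else if c = 1 then \<langle>Suc v, s\<rangle>
     else if c = 2 then \<langle>\<pi>\<^sub>1 v, s\<rangle>
     else if c = 3 then \<langle>\<pi>\<^sub>2 v, s\<rangle>
     else let q = (c - 4) div 4; m = (c - 4) mod 4 in
       if m = 0 then \<langle>v, push 0 (\<pi>\<^sub>1 q) (push 1 \<langle>\<pi>\<^sub>2 q, v\<rangle> s)\<rangle>
       else if m = 1 then \<langle>v, push 0 (\<pi>\<^sub>2 q) (push 0 (\<pi>\<^sub>1 q) s)\<rangle>
       else if m = 2 then \<langle>\<pi>\<^sub>1 v, push 0 (\<pi>\<^sub>1 q) (push 3 \<langle>\<pi>\<^sub>2 q, \<langle>\<pi>\<^sub>1 v, \<langle>0, \<pi>\<^sub>2 v\<rangle>\<rangle>\<rangle> s)\<rangle>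
       else \<langle>\<langle>v, 0\<rangle>, push 0 q (push 4 \<langle>q, \<langle>v, 0\<rangle>\<rangle> s)\<rangle>)"

definition frame_step :: "nat \<Rightarrow> nat \<Rightarrow> nat \<Rightarrow> nat \<Rightarrow> nat" where
  "frame_step tag d v s =
    (if tag = 0 then start_step d v s
     else if tag = 1 then \<langle>\<pi>\<^sub>2 d, push 0 (\<pi>\<^sub>1 d) (push 2 v s)\<rangle>
     else if tag = 2 then \<langle>\<langle>d, v\<rangle>, s\<rangle>
     else if tag = 3 then
       let g = \<pi>\<^sub>1 d; b = \<pi>\<^sub>1 (\<pi>\<^sub>2 d); k = \<pi>\<^sub>1 (\<pi>\<^sub>2 (\<pi>\<^sub>2 d)); n = \<pi>\<^sub>2 (\<pi>\<^sub>2 (\<pi>\<^sub>2 d)) in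
       if n = 0 then \<langle>v, s\<rangle>
       else \<langle>\<langle>b, \<langle>k, v\<rangle>\<rangle>, push 0 g (push 3 \<langle>g, \<langle>b, \<langle>Suc k, n - 1\<rangle>\<rangle>\<rangle> s)\<rangle>
     else
       let f = \<pi>\<^sub>1 d; a = \<pi>\<^sub>1 (\<pi>\<^sub>2 d); k = \<pi>\<^sub>2 (\<pi>\<^sub>2 d) in
       if v = 0 then \<langle>k, s\<rangle>
       else \<langle>\<langle>a, Suc k\<rangle>, push 0 f (push 4 \<langle>f, \<langle>a, Suc k\<rangle>\<rangle> s)\<rangle>)"

definition machine_step :: "nat \<Rightarrow> nat" where
  "machine_step st =
    (if \<pi>\<^sub>2 st = 0 then st
     else let f = \<pi>\<^sub>1 (\<pi>\<^sub>2 st - 1) in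
       frame_step (\<pi>\<^sub>1 f) (\<pi>\<^sub>2 f) (\<pi>\<^sub>1 st) (\<pi>\<^sub>2 (\<pi>\<^sub>2 st - 1)))"

lemma computable_machine_step: "computable machine_step"
  unfolding machine_step_def[abs_def] frame_step_def start_step_def Let_def
  by (intro computable_intros)

definition reaches :: "nat \<Rightarrow> nat \<Rightarrow> bool" where
  "reaches s t \<longleftrightarrow> (\<exists>n. (machine_step ^^ n) s = t)"

lemma reaches_refl: "reaches s s"
  unfolding reaches_def by (rule exI[of _ 0]) simp

lemma reaches_trans [trans]: "reaches s t \<Longrightarrow> reaches t u \<Longrightarrow> reaches s u"
  unfolding reaches_def by (metis funpow_add comp_apply)

lemma reaches_step: "reaches (machine_step s) t \<Longrightarrow> reaches s t"
  unfolding reaches_def by (metis funpow_Suc_right comp_apply)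

lemma div4_simps [simp]:
  "Suc (4 * x) div 4 = x" "Suc (Suc (4 * x)) div 4 = x" "Suc (Suc (Suc (4 * x))) div 4 = x"
  "Suc (4 * x) mod 4 = 1" "Suc (Suc (4 * x)) mod 4 = 2" "Suc (Suc (Suc (4 * x))) mod 4 = 3"
  for x :: nat
  by presburger+

lemma machine_step_push [simp]: "machine_step \<langle>v, push tag d s\<rangle> = frame_step tag d v s"
  by (simp add: machine_step_def)

text \<open>
  Convergence is all that the machine has to reproduce, since realisers and strategies are only ever
  required to be defined at certain arguments.
\<close>
lemma machine_runs_code:
  "eval_code c a = Some v \<Longrightarrow> reaches \<langle>a, push 0 (encode_code c) s\<rangle> \<langle>v, s\<rangle>"
proof (induction c arbitrary: a v s)
  case (Tuple f g)
  then obtain x y where xy: "eval_code f a = Some x" "eval_code g a = Some y" "v = \<langle>x, y\<rangle>"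
    by (auto simp: bind_eq_Some_conv)
  have "reaches \<langle>a, push 0 (encode_code f) (push 1 \<langle>encode_code g, a\<rangle> s)\<rangle>
      \<langle>x, push 1 \<langle>encode_code g, a\<rangle> s\<rangle>"
    by (rule Tuple.IH(1)[OF xy(1)])
  also have "reaches \<dots> \<langle>y, push 2 x s\<rangle>"
    by (rule reaches_step) (simp add: frame_step_def Let_def Tuple.IH(2)[OF xy(2)])
  also have "reaches \<dots> \<langle>v, s\<rangle>"
    by (rule reaches_step) (simp add: frame_step_def Let_def xy(3) reaches_refl)
  finally show ?case
    by - (rule reaches_step, simp add: frame_step_def Let_def start_step_def)
next
  case (Comp f g)
  then obtain x where x: "eval_code g a = Some x" "eval_code f x = Some v"
    by (auto simp: bind_eq_Some_conv)
  have "reaches \<langle>a, push 0 (encode_code g) (push 0 (encode_code f) s)\<rangle> \<langle>v, s\<rangle>"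
    using Comp.IH(2)[OF x(1)] Comp.IH(1)[OF x(2)] by (rule reaches_trans)
  then show ?case
    by - (rule reaches_step, simp add: frame_step_def Let_def start_step_def)
next
  case (Prec f g)
  define b n where "b = \<pi>\<^sub>1 a" and "n = \<pi>\<^sub>2 a"
  define val where "val = rec_nat (eval_code f b)
       (\<lambda>k v. Option.bind v (\<lambda>r. eval_code g \<langle>b, \<langle>k, r\<rangle>\<rangle>))"
  \<comment> \<open>The frame on top of \<open>s\<close> while round \<open>k\<close> of \<open>n\<close> is being computed.\<close>
  let ?frame = "\<lambda>k. push 3 \<langle>encode_code g, \<langle>b, \<langle>k, n - k\<rangle>\<rangle>\<rangle> s"
  have run: "reaches \<langle>b, push 0 (encode_code f) (?frame 0)\<rangle> \<langle>r, ?frame k\<rangle>"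
    if "val k = Some r" "k \<le> n" for k r
    using that
  proof (induction k arbitrary: r)
    case 0
    then show ?case using Prec.IH(1) by (simp add: val_def)
  next
    case (Suc k)
    from Suc.prems(1) obtain r' where r': "val k = Some r'" "eval_code g \<langle>b, \<langle>k, r'\<rangle>\<rangle> = Some r"
      by (auto simp: val_def bind_eq_Some_conv)
    have "reaches \<langle>b, push 0 (encode_code f) (?frame 0)\<rangle> \<langle>r', ?frame k\<rangle>"
      using Suc r' by simp
    also have "reaches \<dots> \<langle>r, ?frame (Suc k)\<rangle>"
      using Suc.prems(2) Prec.IH(2)[OF r'(2)]
      by - (rule reaches_step, simp add: frame_step_def Let_def)
    finally show ?case .
  qed
  have "val n = Some v" using Prec.prems by (simp add: val_def b_def n_def)
  then have "reaches \<langle>b, push 0 (encode_code f) (?frame 0)\<rangle> \<langle>v, ?frame n\<rangle>"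
    by (rule run) simp
  also have "reaches \<dots> \<langle>v, s\<rangle>"
    by (rule reaches_step) (simp add: frame_step_def Let_def reaches_refl)
  finally show ?case
    by - (rule reaches_step, simp add: frame_step_def Let_def start_step_def b_def n_def)
next
  case (Mu f)
  define zero where "zero k \<longleftrightarrow> eval_code f \<langle>a, k\<rangle> = Some 0" for k
  from Mu.prems obtain k where k: "zero k" "\<forall>i<k. eval_code f \<langle>a, i\<rangle> \<noteq> None"
    and v: "v = (LEAST k. zero k)"
    by (auto simp: zero_def split: if_splits)
  have "zero v" using k(1) unfolding v by (rule LeastI)
  have "v \<le> k" using k(1) unfolding v by (rule Least_le)
  let ?search = "\<lambda>i. \<langle>\<langle>a, i\<rangle>, push 0 (encode_code f) (push 4 \<langle>encode_code f, \<langle>a, i\<rangle>\<rangle> s)\<rangle>"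
  have "reaches (?search 0) (?search i)" if "i \<le> v" for i
    using that
  proof (induction i)
    case 0 show ?case by (rule reaches_refl)
  next
    case (Suc i)
    have "\<not> zero i" using Suc.prems not_less_Least unfolding v by (metis Suc_le_eq)
    with k(2) Suc.prems \<open>v \<le> k\<close> obtain w where w: "eval_code f \<langle>a, i\<rangle> = Some w" "w \<noteq> 0"
      unfolding zero_def by (metis Suc_le_eq less_le_trans not_None_eq)
    have "reaches (?search 0) (?search i)" using Suc by simp
    also have "reaches \<dots> \<langle>w, push 4 \<langle>encode_code f, \<langle>a, i\<rangle>\<rangle> s\<rangle>"
      by (rule Mu.IH[OF w(1)])
    also have "reaches \<dots> (?search (Suc i))"
      using w(2) by - (rule reaches_step, simp add: frame_step_def Let_def reaches_refl)
    finally show ?case .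
  qed
  then have "reaches (?search 0) (?search v)" by simp
  also have "reaches \<dots> \<langle>0, push 4 \<langle>encode_code f, \<langle>a, v\<rangle>\<rangle> s\<rangle>"
    using \<open>zero v\<close> unfolding zero_def by (rule Mu.IH)
  also have "reaches \<dots> \<langle>v, s\<rangle>"
    by (rule reaches_step) (simp add: frame_step_def Let_def reaches_refl)
  finally show ?case
    by - (rule reaches_step, simp add: frame_step_def Let_def start_step_def)
qed (rule reaches_step, simp add: frame_step_def Let_def start_step_def reaches_refl)+

text \<open>
  Run the machine from \<open>\<langle>a, [\<langle>0, e\<rangle>]\<rangle>\<close>, search for the first moment at which the stack is empty, and
  return the current value. A halted state is a fixed point of the step function, so the first such
  moment carries the right value.
\<close>
lemma universal_index:
  obtains u where "\<And>e a v. phi e a = Some v \<Longrightarrow> phi u \<langle>e, a\<rangle> = Some v"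
proof -
  define run where "run x k = (machine_step ^^ k) \<langle>\<pi>\<^sub>2 x, push 0 (\<pi>\<^sub>1 x) 0\<rangle>" for x k
  have "run x k = rec_nat \<langle>\<pi>\<^sub>2 x, push 0 (\<pi>\<^sub>1 x) 0\<rangle> (\<lambda>k r. machine_step r) k" for x k
    unfolding run_def by (induction k) auto
  then have run: "computable (\<lambda>y. run (\<pi>\<^sub>1 y) (\<pi>\<^sub>2 y))"
    by (simp, intro computable_rec computable_comp[OF computable_machine_step] computable_intros)
  from computable_right[OF run] obtain c
    where c: "\<And>y. eval_code c y = Some (\<pi>\<^sub>2 (run (\<pi>\<^sub>1 y) (\<pi>\<^sub>2 y)))" by (rule computableE) blast
  from computable_left[OF run] obtain d
    where d: "\<And>y. eval_code d y = Some (\<pi>\<^sub>1 (run (\<pi>\<^sub>1 y) (\<pi>\<^sub>2 y)))" by (rule computableE) blast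
  obtain i where i: "\<And>y. eval_code i y = Some y"
    using computable_id by (rule computableE) blast
  have "eval_code (Comp d (Tuple i (Mu c))) \<langle>e, a\<rangle> = Some v" if v: "phi e a = Some v" for e a v
  proof -
    obtain p where "e = encode_code p" by (rule encode_code_cases)
    with v machine_runs_code[of p a v 0] obtain n where n: "run \<langle>e, a\<rangle> n = \<langle>v, 0\<rangle>"
      by (auto simp: reaches_def run_def)
    define m where "m = (LEAST k. \<pi>\<^sub>2 (run \<langle>e, a\<rangle> k) = 0)"
    have m: "\<pi>\<^sub>2 (run \<langle>e, a\<rangle> m) = 0" "m \<le> n"
      unfolding m_def by (rule LeastI[of _ n], simp add: n, rule Least_le, simp add: n)
    have "run \<langle>e, a\<rangle> (j + m) = run \<langle>e, a\<rangle> m" for j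
    proof (induction j)
      case (Suc j)
      have "run \<langle>e, a\<rangle> (Suc j + m) = machine_step (run \<langle>e, a\<rangle> (j + m))" by (simp add: run_def)
      also have "\<dots> = run \<langle>e, a\<rangle> m" unfolding Suc using m(1) by (simp add: machine_step_def)
      finally show ?case .
    qed simp
    from this[of "n - m"] m(2) n have "run \<langle>e, a\<rangle> m = \<langle>v, 0\<rangle>" by simp
    moreover have "eval_code (Mu c) \<langle>e, a\<rangle> = Some m"
      using n by (auto simp: c m_def intro!: exI[of _ n])
    ultimately show ?thesis by (simp add: i d del: eval_code.simps(8))
  qed
  then show ?thesis using that by (metis phi_encode_code)
qed

section \<open>Parametrisation and self-reference\<close>

text \<open>
  Written out from the numbering of \<open>Comp\<close>, so that its computability is visible.
\<close>
definition comp_index :: "nat \<Rightarrow> nat \<Rightarrow> nat" where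
  "comp_index e d = 4 * \<langle>e, d\<rangle> + 5"

lemma phi_comp_index [simp]: "phi (comp_index e d) a = Option.bind (phi d a) (phi e)"
proof -
  obtain b c where "e = encode_code b" "d = encode_code c" by (metis encode_code_cases)
  moreover then have "comp_index e d = encode_code (Comp b c)" by (simp add: comp_index_def)
  ultimately show ?thesis by (metis eval_code.simps(6) phi_encode_code)
qed

lemma computable_comp_index:
  "computable f \<Longrightarrow> computable g \<Longrightarrow> computable (\<lambda>x. comp_index (f x) (g x))"
  unfolding comp_index_def by (intro computable_intros)

primrec const_code :: "nat \<Rightarrow> code" where
  "const_code 0 = Zero"
| "const_code (Suc n) = Comp Succ (const_code n)"

lemma eval_const_code [simp]: "eval_code (const_code n) a = Some n"
  by (induction n) auto

text \<open>
  The s-m-n function: \<open>Tuple Proj1 Proj2\<close> is a program for the identity.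
\<close>
definition smn :: "nat \<Rightarrow> nat \<Rightarrow> nat" where
  "smn e a = comp_index e (encode_code (Tuple (const_code a) (Tuple Proj1 Proj2)))"

lemma phi_smn [simp]: "phi (smn e a) b = phi e \<langle>a, b\<rangle>"
  by (simp add: smn_def del: encode_code.simps)

lemma computable_smn:
  assumes "computable f" "computable g"
  shows "computable (\<lambda>x. smn (f x) (g x))"
proof -
  have "encode_code (const_code n) = rec_nat 0 (\<lambda>k r. comp_index 1 r) n" for n
    by (induction n) (auto simp: comp_index_def)
  then have "computable (\<lambda>x. encode_code (const_code (g x)))"
    using assms(2) by (auto intro!: computable_rec computable_comp_index computable_basic)
  then show ?thesis
    unfolding smn_def encode_code.simps
    using assms(1) by (intro computable_comp_index computable_intros)
qed

lemmas program_intros = computable_intros computable_comp_index computable_smn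

text \<open>
  The recursion theorem in a form suited to programming: there is a program whose value at \<open>x\<close> is
  one final call of \<open>F e x\<close> on \<open>G e x\<close>, where \<open>F\<close> and \<open>G\<close> are total and may use its own index \<open>e\<close>. Choosing the
  called index by a total case distinction avoids a conditional with partial branches, which
  \<open>Prec\<close> could not supply because it evaluates its base case always.
  The index is Kleene's diagonal \<open>smn n n\<close>.
\<close>
theorem recursive_program:
  assumes "computable (\<lambda>y. F (\<pi>\<^sub>1 y) (\<pi>\<^sub>2 y))" "computable (\<lambda>y. G (\<pi>\<^sub>1 y) (\<pi>\<^sub>2 y))"
  obtains e where "\<And>x v. phi (F e x) (G e x) = Some v \<Longrightarrow> phi e x = Some v"
proof -
  obtain u where u: "\<And>e a v. phi e a = Some v \<Longrightarrow> phi u \<langle>e, a\<rangle> = Some v"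
    by (rule universal_index) blast
  let ?self = "\<lambda>y. smn (\<pi>\<^sub>1 y) (\<pi>\<^sub>1 y)"
  have "computable (\<lambda>y. \<langle>F (?self y) (\<pi>\<^sub>2 y), G (?self y) (\<pi>\<^sub>2 y)\<rangle>)"
    using assms[THEN computable_comp, of "\<lambda>y. \<langle>?self y, \<pi>\<^sub>2 y\<rangle>"]
    by (simp add: program_intros)
  then obtain d where
    d: "\<And>y. phi d y = Some \<langle>F (?self y) (\<pi>\<^sub>2 y), G (?self y) (\<pi>\<^sub>2 y)\<rangle>"
    unfolding computable_def by blast
  define n where "n = comp_index u d"
  show ?thesis
  proof (rule that)
    fix x v
    assume "phi (F (smn n n) x) (G (smn n n) x) = Some v"
    from u[OF this] show "phi (smn n n) x = Some v"
      unfolding phi_smn by (simp add: n_def d)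
  qed
qed

section \<open>The basic topology as a set of dialogues\<close>

text \<open>
  The topology of Lee and van Oosten: the least \<open>X\<close> with \<open>\<langle>0, a\<rangle> \<in> X\<close> for \<open>a \<in> p\<close> and \<open>\<langle>1, e\<rangle> \<in> X\<close> for
  \<open>e \<in> G_op \<A> X\<close>.
\<close>
inductive_set dialogues :: "nat set set \<Rightarrow> nat set \<Rightarrow> nat set" for \<A> p where
  ret: "a \<in> p \<Longrightarrow> \<langle>0, a\<rangle> \<in> dialogues \<A> p"
| ask: "A \<in> \<A> \<Longrightarrow> (\<And>a. a \<in> A \<Longrightarrow> \<exists>b. b \<in> dialogues \<A> p \<and> phi e a = Some b) \<Longrightarrow> \<langle>1, e\<rangle> \<in> dialogues \<A> p"

lemma index_ret: obtains \<eta> where "\<And>a. phi \<eta> a = Some \<langle>0, a\<rangle>"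
proof -
  have "computable (\<lambda>a. \<langle>0, a\<rangle>)" by (intro program_intros)
  then show ?thesis using that unfolding computable_def by blast
qed

lemma index_ask: obtains \<alpha> where "\<And>a. phi \<alpha> a = Some \<langle>1, a\<rangle>"
proof -
  have "computable (\<lambda>a. \<langle>1, a\<rangle>)" by (intro program_intros)
  then show ?thesis using that unfolding computable_def by blast
qed

lemma index_id: obtains i where "\<And>a. phi i a = Some a"
  using computable_id unfolding computable_def by blast

lemma ret_realises: "(\<And>a. phi \<eta> a = Some \<langle>0, a\<rangle>) \<Longrightarrow> \<eta> \<in> p \<rightarrow>\<^sub>r dialogues \<A> p"
  by (simp add: rimp_def dialogues.ret)

lemma ask_realises: "(\<And>a. phi \<alpha> a = Some \<langle>1, a\<rangle>) \<Longrightarrow> \<alpha> \<in> G_op \<A> (dialogues \<A> p) \<rightarrow>\<^sub>r dialogues \<A> p"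
  unfolding rimp_def G_op_def by (fastforce intro: dialogues.ask)

lemma comp_realises:
  "e \<in> q \<rightarrow>\<^sub>r r \<Longrightarrow> d \<in> p \<rightarrow>\<^sub>r q \<Longrightarrow> comp_index e d \<in> p \<rightarrow>\<^sub>r r"
  unfolding rimp_def by fastforce

text \<open>
  \<open>dialogues \<A> p\<close> is, uniformly, the initial algebra of \<open>G_op \<A>\<close> under \<open>p\<close>: the realiser recurses
  through a dialogue with \<open>r\<close> at the leaves and \<open>m\<close> at the queries. Monotonicity, the joining of
  nested dialogues and leastness among topologies are instances of this one recursion.
\<close>
theorem dialogues_initial:
  obtains e where "\<And>\<A> p q r m. r \<in> p \<rightarrow>\<^sub>r q \<Longrightarrow> m \<in> G_op \<A> q \<rightarrow>\<^sub>r q \<Longrightarrow>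
      smn e \<langle>r, m\<rangle> \<in> dialogues \<A> p \<rightarrow>\<^sub>r q"
proof -
  define F :: "nat \<Rightarrow> nat \<Rightarrow> nat" where
    "F e x = (if \<pi>\<^sub>1 (\<pi>\<^sub>2 x) = 0 then \<pi>\<^sub>1 (\<pi>\<^sub>1 x) else \<pi>\<^sub>2 (\<pi>\<^sub>1 x))" for e x
  define G where
    "G e x = (if \<pi>\<^sub>1 (\<pi>\<^sub>2 x) = 0 then \<pi>\<^sub>2 (\<pi>\<^sub>2 x) else comp_index (smn e (\<pi>\<^sub>1 x)) (\<pi>\<^sub>2 (\<pi>\<^sub>2 x)))"
    for e x
  obtain e where e: "\<And>x v. phi (F e x) (G e x) = Some v \<Longrightarrow> phi e x = Some v"
  proof (rule recursive_program)
    show "computable (\<lambda>y. F (\<pi>\<^sub>1 y) (\<pi>\<^sub>2 y))" "computable (\<lambda>y. G (\<pi>\<^sub>1 y) (\<pi>\<^sub>2 y))"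
      unfolding F_def G_def by (intro program_intros)+
  qed blast
  have "smn e \<langle>r, m\<rangle> \<in> dialogues \<A> p \<rightarrow>\<^sub>r q"
    if r: "r \<in> p \<rightarrow>\<^sub>r q" and m: "m \<in> G_op \<A> q \<rightarrow>\<^sub>r q" for \<A> p q r m
  proof -
    have "\<exists>v\<in>q. phi (smn e \<langle>r, m\<rangle>) x = Some v" if "x \<in> dialogues \<A> p" for x
      using that
    proof induction
      case (ret a)
      with r obtain v where "v \<in> q" "phi r a = Some v" unfolding rimp_def by blast
      then show ?case using e[of "\<langle>\<langle>r, m\<rangle>, \<langle>0, a\<rangle>\<rangle>" v] by (auto simp: F_def G_def)
    next
      case (ask A d)
      define c where "c = comp_index (smn e \<langle>r, m\<rangle>) d"
      have "c \<in> A \<rightarrow>\<^sub>r q" unfolding rimp_def c_def using ask.IH by fastforce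
      with ask.hyps have "c \<in> G_op \<A> q" unfolding G_op_def by blast
      with m obtain v where "v \<in> q" "phi m c = Some v" unfolding rimp_def by blast
      then show ?case using e[of "\<langle>\<langle>r, m\<rangle>, \<langle>1, d\<rangle>\<rangle>" v] by (auto simp: F_def G_def c_def)
    qed
    then show ?thesis unfolding rimp_def by blast
  qed
  then show ?thesis using that by blast
qed

text \<open>
  Monotonicity is the recursion with the leaves relabelled, and joining nested dialogues is
  the recursion with the identity at the leaves.
\<close>
theorem LT_topology_dialogues: "LT_topology (dialogues \<A>)"
proof -
  obtain \<eta> where \<eta>: "\<And>a. phi \<eta> a = Some \<langle>0, a\<rangle>" by (rule index_ret) blast
  obtain \<alpha> where \<alpha>: "\<And>a. phi \<alpha> a = Some \<langle>1, a\<rangle>" by (rule index_ask) blast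
  obtain i where i: "\<And>a. phi i a = Some a" by (rule index_id) blast
  obtain e where e: "\<And>\<A> p q r m. r \<in> p \<rightarrow>\<^sub>r q \<Longrightarrow> m \<in> G_op \<A> q \<rightarrow>\<^sub>r q \<Longrightarrow>
      smn e \<langle>r, m\<rangle> \<in> dialogues \<A> p \<rightarrow>\<^sub>r q" by (rule dialogues_initial) blast
  have "computable (\<lambda>r. smn e \<langle>comp_index \<eta> r, \<alpha>\<rangle>)" by (intro program_intros)
  then obtain f where f: "\<And>r. phi f r = Some (smn e \<langle>comp_index \<eta> r, \<alpha>\<rangle>)"
    unfolding computable_def by blast
  have "smn e \<langle>comp_index \<eta> r, \<alpha>\<rangle> \<in> dialogues \<A> p \<rightarrow>\<^sub>r dialogues \<A> q" if "r \<in> p \<rightarrow>\<^sub>r q" for p q r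
    using comp_realises[OF ret_realises[OF \<eta>] that] ask_realises[OF \<alpha>] by (rule e)
  then have "f \<in> (p \<rightarrow>\<^sub>r q) \<rightarrow>\<^sub>r (dialogues \<A> p \<rightarrow>\<^sub>r dialogues \<A> q)" for p q
    unfolding rimp_def[of "p \<rightarrow>\<^sub>r q"] by (simp add: f)
  moreover have "\<langle>smn e \<langle>i, \<alpha>\<rangle>, \<eta>\<rangle> \<in> dialogues \<A> (dialogues \<A> p) \<leftrightarrow>\<^sub>r dialogues \<A> p" for p
  proof -
    have "i \<in> dialogues \<A> p \<rightarrow>\<^sub>r dialogues \<A> p" by (simp add: rimp_def i)
    from e[OF this ask_realises[OF \<alpha>]] show ?thesis
      unfolding riff_def using ret_realises[OF \<eta>] by blast
  qed
  moreover have "\<eta> \<in> p \<rightarrow>\<^sub>r dialogues \<A> p" for p by (rule ret_realises[OF \<eta>])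
  ultimately show ?thesis
    unfolding LT_topology_def valid_def by auto
qed

text \<open>
  For a topology \<open>k\<close> above \<open>G_op \<A>\<close>, a query inside \<open>k p\<close> is absorbed by going through \<open>k (k p)\<close>.
\<close>
lemma dialogues_least:
  assumes "LT_topology k" "valid (\<lambda>p. G_op \<A> p \<rightarrow>\<^sub>r k p)"
  shows "topology_le (dialogues \<A>) k"
proof -
  obtain e where e: "\<And>\<A> p q r m. r \<in> p \<rightarrow>\<^sub>r q \<Longrightarrow> m \<in> G_op \<A> q \<rightarrow>\<^sub>r q \<Longrightarrow>
      smn e \<langle>r, m\<rangle> \<in> dialogues \<A> p \<rightarrow>\<^sub>r q" by (rule dialogues_initial) blast
  from assms(1) obtain r where r: "\<And>p. r \<in> p \<rightarrow>\<^sub>r k p"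
    unfolding LT_topology_def valid_def by blast
  from assms(1) obtain u where "\<And>p. u \<in> k (k p) \<leftrightarrow>\<^sub>r k p"
    unfolding LT_topology_def valid_def by blast
  then have u: "\<pi>\<^sub>1 u \<in> k (k p) \<rightarrow>\<^sub>r k p" for p unfolding riff_def by fastforce
  from assms(2) obtain g where g: "\<And>p. g \<in> G_op \<A> p \<rightarrow>\<^sub>r k p" unfolding valid_def by blast
  have "smn e \<langle>r, comp_index (\<pi>\<^sub>1 u) g\<rangle> \<in> dialogues \<A> p \<rightarrow>\<^sub>r k p" for p
    by (rule e[OF r comp_realises[OF u g]])
  then show ?thesis unfolding topology_le_def valid_def by blast
qed

lemma G_op_le_dialogues: "valid (\<lambda>p. G_op \<A> p \<rightarrow>\<^sub>r dialogues \<A> p)"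
proof -
  obtain \<eta> where \<eta>: "\<And>a. phi \<eta> a = Some \<langle>0, a\<rangle>" by (rule index_ret) blast
  obtain \<alpha> where \<alpha>: "\<And>a. phi \<alpha> a = Some \<langle>1, a\<rangle>" by (rule index_ask) blast
  have "computable (comp_index \<eta>)"
    using computable_comp_index[OF computable_const computable_id, of \<eta>] by simp
  then obtain f where f: "\<And>e. phi f e = Some (comp_index \<eta> e)"
    unfolding computable_def by blast
  have "f \<in> G_op \<A> p \<rightarrow>\<^sub>r G_op \<A> (dialogues \<A> p)" for p
    unfolding rimp_def[of "G_op \<A> p"]
    using comp_realises[OF ret_realises[OF \<eta>]] unfolding G_op_def by (simp add: f) blast
  then have "comp_index \<alpha> f \<in> G_op \<A> p \<rightarrow>\<^sub>r dialogues \<A> p" for p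
    by (rule comp_realises[OF ask_realises[OF \<alpha>]])
  then show ?thesis unfolding valid_def by blast
qed

theorem dialogues_basic: "dialogues \<A> \<in> basic_topology \<A>"
  unfolding basic_topology_def using LT_topology_dialogues G_op_le_dialogues dialogues_least by blast

text \<open>
  For \<open>A \<in> \<U>\<close> the identity lies in \<open>G_op \<U> A\<close>, so a realiser of the comparison sends it to one
  number in \<open>dialogues \<V> A\<close>, the same for all \<open>A\<close>. Conversely, given \<open>e \<in> A \<rightarrow>\<^sub>r p\<close> with \<open>A \<in> \<U>\<close>,
  monotonicity carries a common element \<open>d\<close> into \<open>dialogues \<V> p\<close>; the realiser need not know \<open>A\<close>.
\<close>
theorem LT_le_iff_common_element: "\<U> \<le>\<^sub>L\<^sub>T \<V> \<longleftrightarrow> (\<exists>d. \<forall>A\<in>\<U>. d \<in> dialogues \<V> A)"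
proof
  assume "\<U> \<le>\<^sub>L\<^sub>T \<V>"
  then obtain j k where j: "j \<in> basic_topology \<U>" and k: "k \<in> basic_topology \<V>"
    and "topology_le j k" unfolding LT_le_def by blast
  then obtain e where e: "\<And>p. e \<in> j p \<rightarrow>\<^sub>r k p" unfolding topology_le_def valid_def by blast
  from j obtain g where g: "\<And>p. g \<in> G_op \<U> p \<rightarrow>\<^sub>r j p"
    unfolding basic_topology_def valid_def by blast
  from k have "topology_le k (dialogues \<V>)"
    unfolding basic_topology_def using LT_topology_dialogues G_op_le_dialogues by blast
  then obtain f where f: "\<And>p. f \<in> k p \<rightarrow>\<^sub>r dialogues \<V> p" unfolding topology_le_def valid_def by blast
  define r where "r = comp_index f (comp_index e g)"
  have r: "r \<in> G_op \<U> p \<rightarrow>\<^sub>r dialogues \<V> p" for p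
    unfolding r_def by (rule comp_realises[OF f comp_realises[OF e g]])
  obtain i where i: "\<And>a. phi i a = Some a" by (rule index_id) blast
  have "the (phi r i) \<in> dialogues \<V> A" if "A \<in> \<U>" for A
  proof -
    have "i \<in> G_op \<U> A" using that by (auto simp: G_op_def rimp_def i)
    with r[of A] show ?thesis unfolding rimp_def by auto
  qed
  then show "\<exists>d. \<forall>A\<in>\<U>. d \<in> dialogues \<V> A" by blast
next
  assume "\<exists>d. \<forall>A\<in>\<U>. d \<in> dialogues \<V> A"
  then obtain d where d: "\<And>A. A \<in> \<U> \<Longrightarrow> d \<in> dialogues \<V> A" by blast
  from LT_topology_dialogues[of \<V>] obtain m where
    m: "\<And>p q. m \<in> (p \<rightarrow>\<^sub>r q) \<rightarrow>\<^sub>r (dialogues \<V> p \<rightarrow>\<^sub>r dialogues \<V> q)"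
    unfolding LT_topology_def valid_def by auto
  obtain u where u: "\<And>e a v. phi e a = Some v \<Longrightarrow> phi u \<langle>e, a\<rangle> = Some v"
    by (rule universal_index) blast
  have "computable (\<lambda>e. \<langle>e, d\<rangle>)" by (intro program_intros)
  then obtain h where h: "\<And>e. phi h e = Some \<langle>e, d\<rangle>" unfolding computable_def by blast
  have "comp_index u (comp_index h m) \<in> G_op \<U> p \<rightarrow>\<^sub>r dialogues \<V> p" for p
    unfolding rimp_def[of "G_op \<U> p"]
  proof clarify
    fix e assume "e \<in> G_op \<U> p"
    then obtain A where A: "A \<in> \<U>" "e \<in> A \<rightarrow>\<^sub>r p" unfolding G_op_def by blast
    with m[of A p] obtain f where f: "phi m e = Some f" "f \<in> dialogues \<V> A \<rightarrow>\<^sub>r dialogues \<V> p"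
      unfolding rimp_def[of "A \<rightarrow>\<^sub>r p"] by blast
    with d[OF A(1)] obtain v where v: "v \<in> dialogues \<V> p" "phi f d = Some v"
      unfolding rimp_def by blast
    then show "\<exists>b\<in>dialogues \<V> p. phi (comp_index u (comp_index h m)) e = Some b"
      using f(1) u[OF v(2)] by (simp add: h)
  qed
  then have "topology_le (dialogues \<U>) (dialogues \<V>)"
    by (intro dialogues_least LT_topology_dialogues) (auto simp: valid_def)
  then show "\<U> \<le>\<^sub>L\<^sub>T \<V>" unfolding LT_le_def using dialogues_basic by blast
qed

section \<open>Computable strategies\<close>

text \<open>
  The move prescribed by a dialogue after a string of answers. Each answer \<open>x\<close> is fed to the
  current continuation \<open>e\<close>, which is known only at run time; this is where a universal function
  is essential.
\<close>
lemma interpreter_index: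
  obtains r where
    "\<And>a. phi r \<langle>\<langle>0, a\<rangle>, list_encode []\<rangle> = Some \<langle>1, a\<rangle>"
    "\<And>e. phi r \<langle>\<langle>1, e\<rangle>, list_encode []\<rangle> = Some 0"
    "\<And>e x c \<rho> v. phi e x = Some c \<Longrightarrow> phi r \<langle>c, list_encode \<rho>\<rangle> = Some v \<Longrightarrow>
        phi r \<langle>\<langle>1, e\<rangle>, list_encode (x # \<rho>)\<rangle> = Some v"
proof -
  obtain i where i: "\<And>a. phi i a = Some a" by (rule index_id) blast
  have "computable (\<lambda>y. \<langle>\<pi>\<^sub>2 y, \<pi>\<^sub>1 y\<rangle>)" by (intro program_intros)
  then obtain sw where sw: "\<And>y. phi sw y = Some \<langle>\<pi>\<^sub>2 y, \<pi>\<^sub>1 y\<rangle>" unfolding computable_def by blast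
  define F where "F r y =
    (if \<pi>\<^sub>2 y = 0 then i
     else comp_index (comp_index r (smn sw (\<pi>\<^sub>2 (\<pi>\<^sub>2 y - 1)))) (\<pi>\<^sub>2 (\<pi>\<^sub>1 y)))" for r y
  define G :: "nat \<Rightarrow> nat \<Rightarrow> nat" where "G r y =
    (if \<pi>\<^sub>2 y = 0 then if \<pi>\<^sub>1 (\<pi>\<^sub>1 y) = 0 then \<langle>1, \<pi>\<^sub>2 (\<pi>\<^sub>1 y)\<rangle> else 0
     else \<pi>\<^sub>1 (\<pi>\<^sub>2 y - 1))" for r y
  obtain r where r: "\<And>y v. phi (F r y) (G r y) = Some v \<Longrightarrow> phi r y = Some v"
  proof (rule recursive_program)
    show "computable (\<lambda>y. F (\<pi>\<^sub>1 y) (\<pi>\<^sub>2 y))" "computable (\<lambda>y. G (\<pi>\<^sub>1 y) (\<pi>\<^sub>2 y))"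
      unfolding F_def G_def by (intro program_intros)+
  qed blast
  show ?thesis
    by (rule that[of r]; rule r) (simp_all add: F_def G_def i sw)
qed

lemma snoc_index:
  obtains s where "\<And>\<sigma> x. phi s \<langle>list_encode \<sigma>, x\<rangle> = Some (list_encode (\<sigma> @ [x]))"
proof -
  obtain i where i: "\<And>a. phi i a = Some a" by (rule index_id) blast
  have "computable Suc" using computable_Suc[OF computable_id] .
  then obtain cons where cons: "\<And>y. phi cons y = Some (Suc y)" unfolding computable_def by blast
  define F where "F s y =
    (if \<pi>\<^sub>1 y = 0 then i else comp_index (smn cons (\<pi>\<^sub>1 (\<pi>\<^sub>1 y - 1))) s)" for s y
  define G :: "nat \<Rightarrow> nat \<Rightarrow> nat" where "G s y =
    (if \<pi>\<^sub>1 y = 0 then Suc \<langle>\<pi>\<^sub>2 y, 0\<rangle> else \<langle>\<pi>\<^sub>2 (\<pi>\<^sub>1 y - 1), \<pi>\<^sub>2 y\<rangle>)" for s y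
  obtain s where s: "\<And>y v. phi (F s y) (G s y) = Some v \<Longrightarrow> phi s y = Some v"
  proof (rule recursive_program)
    show "computable (\<lambda>y. F (\<pi>\<^sub>1 y) (\<pi>\<^sub>2 y))" "computable (\<lambda>y. G (\<pi>\<^sub>1 y) (\<pi>\<^sub>2 y))"
      unfolding F_def G_def by (intro program_intros)+
  qed blast
  have "phi s \<langle>list_encode \<sigma>, x\<rangle> = Some (list_encode (\<sigma> @ [x]))" for \<sigma> x
    by (induction \<sigma>; rule s) (simp_all add: F_def G_def i cons)
  then show ?thesis using that by blast
qed

text \<open>
  The dialogue is prefixed by one query whose answer is ignored, since \<open>d\<close> may stop at once while
  the game demands a first query. The induction follows \<open>dialogues\<close>, keeping track of the dialogue \<open>b\<close> that remains
  after the answers \<open>\<sigma>\<close>.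
\<close>
lemma common_element_imp_computable:
  assumes "\<And>A. A \<in> \<U> \<Longrightarrow> d \<in> dialogues \<V> A" "upper_set \<V>"
  shows "computably_gamified_katetov_le \<U> \<V>"
proof -
  obtain r where
    r0: "\<And>a. phi r \<langle>\<langle>0, a\<rangle>, list_encode []\<rangle> = Some \<langle>1, a\<rangle>" and
    r1: "\<And>e. phi r \<langle>\<langle>1, e\<rangle>, list_encode []\<rangle> = Some 0" and
    r2: "\<And>e x c \<rho> v. phi e x = Some c \<Longrightarrow> phi r \<langle>c, list_encode \<rho>\<rangle> = Some v \<Longrightarrow>
        phi r \<langle>\<langle>1, e\<rangle>, list_encode (x # \<rho>)\<rangle> = Some v"
    by (rule interpreter_index) blast
  obtain c where c: "\<And>a. phi c a = Some d"
    using computable_const unfolding computable_def by blast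
  define \<psi> where "\<psi> \<sigma> = phi r \<langle>\<langle>1, c\<rangle>, list_encode \<sigma>\<rangle>" for \<sigma>
  have run: "game_forces \<V> \<psi> A \<sigma>"
    if "b \<in> dialogues \<V> A" "\<And>\<rho> v. phi r \<langle>b, list_encode \<rho>\<rangle> = Some v \<Longrightarrow> \<psi> (\<sigma> @ \<rho>) = Some v" for A \<sigma> b
    using that
  proof (induction arbitrary: \<sigma>)
    case (ret a)
    from ret.prems[OF r0] have "\<psi> \<sigma> = Some \<langle>1, a\<rangle>" by simp
    with ret.hyps show ?case by (intro forces.now) blast
  next
    case (ask B e)
    show ?case
    proof (rule forces.ask)
      show "\<psi> \<sigma> = Some 0" using ask.prems[OF r1] by simp
      show "B \<in> \<V>" by fact
      fix x assume "x \<in> B"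
      from ask.IH[OF this] obtain b where b: "phi e x = Some b"
        "\<And>\<sigma>. (\<And>\<rho> v. phi r \<langle>b, list_encode \<rho>\<rangle> = Some v \<Longrightarrow> \<psi> (\<sigma> @ \<rho>) = Some v) \<Longrightarrow>
          game_forces \<V> \<psi> A \<sigma>" by blast
      show "game_forces \<V> \<psi> A (\<sigma> @ [x])"
        by (rule b(2)) (use ask.prems[OF r2[OF b(1)]] in simp)
    qed
  qed
  have "game_forces \<V> \<psi> A []" if "A \<in> \<U>" for A
  proof (rule run)
    show "\<langle>1, c\<rangle> \<in> dialogues \<V> A"
      using upper_setD(3)[OF assms(2)] assms(1)[OF that] by (intro dialogues.ask) (auto simp: c)
  qed (simp add: \<psi>_def)
  moreover have "\<psi> [] = Some 0" unfolding \<psi>_def by (rule r1)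
  moreover have "partial_computable_on_strings \<psi>"
    unfolding partial_computable_on_strings_def
    by (rule exI[of _ "smn r \<langle>1, c\<rangle>"]) (simp add: \<psi>_def)
  ultimately show ?thesis
    unfolding computably_gamified_katetov_le_def using winning_strategy_iff_forces by blast
qed

text \<open>
  The dialogue \<open>f (\<sigma>)\<close> at position \<open>\<sigma>\<close> is defined from \<open>\<psi> \<sigma>\<close> by self-reference: for a query it is \<open>\<langle>1, e\<rangle>\<close>
  with \<open>e\<close> an index of \<open>x \<mapsto> f (\<sigma> @ [x])\<close>, and for an output \<open>y\<close> it is \<open>\<langle>0, y\<rangle>\<close>. Neither depends on
  \<open>A\<close>, and membership in \<open>dialogues \<V> A\<close> follows the derivation that \<open>\<psi>\<close> forces an output in \<open>A\<close>.
\<close>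
lemma computable_imp_common_element:
  assumes "computably_gamified_katetov_le \<U> \<V>"
  obtains d where "\<And>A. A \<in> \<U> \<Longrightarrow> d \<in> dialogues \<V> A"
proof -
  from assms obtain \<psi> t where t: "\<And>\<sigma>. \<psi> \<sigma> = phi t (list_encode \<sigma>)"
    and "\<exists>\<eta>. winning_strategy \<U> \<V> \<psi> \<eta>"
    unfolding computably_gamified_katetov_le_def partial_computable_on_strings_def by blast
  then have win: "\<And>A. A \<in> \<U> \<Longrightarrow> game_forces \<V> \<psi> A []"
    unfolding winning_strategy_iff_forces by blast
  obtain s where s: "\<And>\<sigma> x. phi s \<langle>list_encode \<sigma>, x\<rangle> = Some (list_encode (\<sigma> @ [x]))"
    by (rule snoc_index) blast
  let ?move = "\<lambda>y. if \<pi>\<^sub>2 y = 0 then \<langle>1, comp_index (\<pi>\<^sub>1 (\<pi>\<^sub>1 y)) (smn s (\<pi>\<^sub>2 (\<pi>\<^sub>1 y)))\<rangle>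
      else \<langle>0, \<pi>\<^sub>2 (\<pi>\<^sub>2 y)\<rangle>"
  have "computable ?move" by (intro program_intros)
  then obtain m where m: "\<And>y. phi m y = Some (?move y)" unfolding computable_def by blast
  obtain f where f: "\<And>x v. phi (comp_index (smn m \<langle>f, x\<rangle>) t) x = Some v \<Longrightarrow> phi f x = Some v"
  proof (rule recursive_program)
    show "computable (\<lambda>y. comp_index (smn m \<langle>\<pi>\<^sub>1 y, \<pi>\<^sub>2 y\<rangle>) t)" "computable (\<lambda>y. \<pi>\<^sub>2 y)"
      by (intro program_intros)+
  qed blast
  have run: "phi f (list_encode \<sigma>) = Some (?move \<langle>\<langle>f, list_encode \<sigma>\<rangle>, v\<rangle>)"
    if "\<psi> \<sigma> = Some v" for \<sigma> v
    using that by (intro f) (simp add: t m)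
  have "\<exists>b. b \<in> dialogues \<V> A \<and> phi f (list_encode \<sigma>) = Some b" if "game_forces \<V> \<psi> A \<sigma>" for A \<sigma>
    using that
  proof induction
    case (now \<sigma>)
    then show ?case using run by (auto intro: dialogues.ret)
  next
    case (ask \<sigma> B)
    have "\<langle>1, comp_index f (smn s (list_encode \<sigma>))\<rangle> \<in> dialogues \<V> A"
      using ask.hyps(2) by (rule dialogues.ask) (use ask.IH in \<open>simp add: s\<close>)
    then show ?case using run[OF ask.hyps(1)] by simp
  qed
  with win have "the (phi f (list_encode [])) \<in> dialogues \<V> A" if "A \<in> \<U>" for A
    using that by fastforce
  then show ?thesis by (rule that)
qed

theorem computably_gamified_iff_LT_le:
  assumes "upper_set \<V>"
  shows "computably_gamified_katetov_le \<U> \<V> \<longleftrightarrow> \<U> \<le>\<^sub>L\<^sub>T \<V>"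
  unfolding LT_le_iff_common_element
  using common_element_imp_computable[OF _ assms] computable_imp_common_element by metis

section \<open>The comparison theorem\<close>

theorem theoremA:
  shows
    "reflp_on {\<U>. upper_set \<U>} (\<le>\<^sub>L\<^sub>T\<^sup>o) \<and> transp_on {\<U>. upper_set \<U>} (\<le>\<^sub>L\<^sub>T\<^sup>o) \<and>
     (\<forall>\<U> \<V>. upper_set \<U> \<longrightarrow> upper_set \<V> \<longrightarrow>
        (\<U> \<le>\<^sub>L\<^sub>T\<^sup>o \<V> \<longleftrightarrow> (\<exists>\<delta>. fence \<V> \<delta> \<and> \<U> \<le>\<^sub>K fubini_power \<V> \<delta>))) \<and>
     (\<forall>\<U>. upper_set \<U> \<longrightarrow> \<U> \<equiv>\<^sub>L\<^sub>T\<^sup>o \<U> \<otimes> \<U>) \<and>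
     strictly_coarser (\<le>\<^sub>L\<^sub>T\<^sup>o) (\<le>\<^sub>R\<^sub>K) \<and>
     strictly_coarser (\<le>\<^sub>L\<^sub>T\<^sup>o) (\<le>\<^sub>K) \<and>
     (\<forall>\<U> \<V>. upper_set \<U> \<longrightarrow> upper_set \<V> \<longrightarrow>
        (\<U> \<le>\<^sub>L\<^sub>T\<^sup>o \<V> \<longleftrightarrow> player_II_wins \<U> \<V>)) \<and>
     (\<forall>\<U> \<V>. upper_set \<U> \<longrightarrow> upper_set \<V> \<longrightarrow>
        (computably_gamified_katetov_le \<U> \<V> \<longleftrightarrow> \<U> \<le>\<^sub>L\<^sub>T \<V>))"
proof (intro conjI allI impI)
  show "reflp_on {\<U>. upper_set \<U>} (\<le>\<^sub>L\<^sub>T\<^sup>o)"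
    by (auto intro: reflp_onI gamified_refl)
  show "transp_on {\<U>. upper_set \<U>} (\<le>\<^sub>L\<^sub>T\<^sup>o)"
    by (auto intro: transp_onI gamified_trans)
  fix \<U> \<V> assume \<U>: "upper_set \<U>" and \<V>: "upper_set \<V>"
  show "\<U> \<le>\<^sub>L\<^sub>T\<^sup>o \<V> \<longleftrightarrow> (\<exists>\<delta>. fence \<V> \<delta> \<and> \<U> \<le>\<^sub>K fubini_power \<V> \<delta>)"
    using \<U> \<V> by (rule gamified_iff_fence)
  show "\<U> \<le>\<^sub>L\<^sub>T\<^sup>o \<V> \<longleftrightarrow> player_II_wins \<U> \<V>"
    using \<V> by (rule gamified_iff_player_II_wins)
  show "computably_gamified_katetov_le \<U> \<V> \<longleftrightarrow> \<U> \<le>\<^sub>L\<^sub>T \<V>"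
    using \<V> by (rule computably_gamified_iff_LT_le)
qed (rule gamified_fubini_square strictly_coarser_katetov strictly_coarser_rudin_keisler; assumption?)+
end
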